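(* Let $d\ge1$ and let $\psi$ be a compactly supported wavelet with associated wavelet basis $(\psi_{\boldsymbol\lambda})_{\boldsymbol\lambda\in\boldsymbol\Lambda}$ of $L^2[0,1]$. Consider the regression model $Y_i=f_0(\mathbf X_i)+\varepsilon_i$, $i=1,\ldots,n$, with uniform design $\mathbf X_i=(U_{i,1},\ldots,U_{i,d})\sim\mathrm{Unif}[0,1]^d$. For an arbitrary index set $I\subset\boldsymbol\Lambda\times\cdots\times\boldsymbol\Lambda$ ($d$ factors), let $\widehat f_n$ be the wavelet estimator $$\widehat f_n(\mathbf x)=\sum_{(\boldsymbol\lambda_1,\ldots,\boldsymbol\lambda_d)\in I}\widehat d_{\boldsymbol\lambda_1\ldots\boldsymbol\lambda_d}(f_0)\prod_{r=1}^d\psi_{\boldsymbol\lambda_r}(x_r),\qquad\widehat d_{\boldsymbol\lambda_1\ldots\boldsymbol\lambda_d}(f_0)=\frac1n\sum_{i=1}^nY_i\prod_{r=1}^d\psi_{\boldsymbol\lambda_r}(U_{i,r}).$$ Then, for any $0<\alpha\le1$ and any Hölder radius $K>0$, $$\sup_{f_0(\mathbf x)=h(\sum_{r=1}^dx_r),\ h\in\mathcal C_1^\alpha([0,d],K)}R(\widehat f_n,f_0)\gtrsim n^{-\frac{2\alpha}{2\alpha+d}},$$ where the implied constant does not depend on $n$ or on $I$.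
   Context: Model: $\mathbf X_1,\ldots,\mathbf X_n$ are i.i.d., $\varepsilon_1,\ldots,\varepsilon_n$ are i.i.d. standard normal and independent of $(\mathbf X_i)_i$. The risk is $R(\widehat f_n,f_0)=E_{f_0}[(\widehat f_n(\mathbf X)-f_0(\mathbf X))^2]$ with $\mathbf X\sim\mathrm{Unif}[0,1]^d$ independent of the sample. Wavelet basis: $(\psi_{\boldsymbol\lambda},\boldsymbol\lambda\in\boldsymbol\Lambda)$ is a compactly supported orthonormal wavelet basis of $L^2(\mathbb R)$ adapted (restricted) to an orthonormal basis of $L^2[0,1]$ in the sense of Cohen, Daubechies and Vial, with $\boldsymbol\Lambda=\{(j,k):j=-1,0,1,\ldots;\ k\in I_j\}$; the $\psi_{-1,k}$ are shifted scaling functions $\phi(\cdot-k)$, and for each level $j\ge0$ the functions $\psi_{j,k}$, $k\in I_j$, are the functions $2^{j/2}\psi(2^j\cdot-k)$ with support in $[0,1]$ (all of them except for a number bounded uniformly in $j$), together with a number, bounded uniformly in $j$, of boundary-adapted functions. Here $\psi\in L^2(\mathbb R)$ is the wavelet function, which has compact support. $\mathcal C_1^\alpha([0,d],K)$ for $0<\alpha\le1$ is the set of $h:[0,d]\to\mathbb R$ with $\|h\|_\infty+\sup_{u\ne v}|h(u)-h(v)|/|u-v|^\alpha\le K$. *)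

theory Defs
  imports "HOL-Probability.Probability"
begin

definition square_integrable :: "'a measure \<Rightarrow> ('a \<Rightarrow> real) \<Rightarrow> bool" where
  "square_integrable M f \<longleftrightarrow> f \<in> borel_measurable M \<and> integrable M (\<lambda>x. (f x)\<^sup>2)"

text \<open>Unconditional convergence of a series of functions in \<open>L\<^sup>2(M)\<close>; the sum \<open>g\<close> is determined
  only up to null sets.\<close>

definition has_sum_L2 ::
    "'a measure \<Rightarrow> ('i \<Rightarrow> 'a \<Rightarrow> real) \<Rightarrow> 'i set \<Rightarrow> ('a \<Rightarrow> real) \<Rightarrow> bool" where
  "has_sum_L2 M u I g \<longleftrightarrow> g \<in> borel_measurable M \<and>
     ((\<lambda>F. \<integral>\<^sup>+x. ennreal ((g x - (\<Sum>i\<in>F. u i x))\<^sup>2) \<partial>M) \<longlongrightarrow> 0) (finite_subsets_at_top I)"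

definition orthonormal_basis_L2 :: "'a measure \<Rightarrow> ('i \<Rightarrow> 'a \<Rightarrow> real) \<Rightarrow> 'i set \<Rightarrow> bool" where
  "orthonormal_basis_L2 M b I \<longleftrightarrow>
     (\<forall>i\<in>I. square_integrable M (b i)) \<and>
     (\<forall>i\<in>I. \<forall>j\<in>I. (\<integral>x. b i x * b j x \<partial>M) = (if i = j then 1 else 0)) \<and>
     (\<forall>f. square_integrable M f \<longrightarrow> has_sum_L2 M (\<lambda>i x. (\<integral>y. f y * b i y \<partial>M) * b i x) I f)"


type_synonym windex = "int \<times> int"

fun wavelet_fun :: "(real \<Rightarrow> real) \<Rightarrow> (real \<Rightarrow> real) \<Rightarrow> windex \<Rightarrow> real \<Rightarrow> real" where
  "wavelet_fun \<phi> \<psi> (j, k) x =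
     (if j = -1 then \<phi> (x - of_int k)
      else 2 powr (of_int j / 2) * \<psi> (2 powr of_int j * x - of_int k))"

text \<open>Scaling function \<open>\<phi>\<close> and wavelet \<open>\<psi>\<close> on the real line. The basis property makes the closed
  span of the integer shifts of \<open>\<phi>\<close> the orthogonal complement of all wavelet levels \<open>j \<ge> 0\<close>, so
  its dyadic dilates form the usual multiresolution analysis.\<close>

definition compactly_supported_wavelet :: "(real \<Rightarrow> real) \<Rightarrow> (real \<Rightarrow> real) \<Rightarrow> bool" where
  "compactly_supported_wavelet \<phi> \<psi> \<longleftrightarrow>
     compact (closure {x. \<phi> x \<noteq> 0}) \<and> compact (closure {x. \<psi> x \<noteq> 0}) \<and>
     orthonormal_basis_L2 lborel (wavelet_fun \<phi> \<psi>) {(j, k). j \<ge> -1}"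

definition inside_unit :: "(real \<Rightarrow> real) \<Rightarrow> bool" where
  "inside_unit f \<longleftrightarrow> closure {x. f x \<noteq> 0} \<subseteq> {0..1}"

text \<open>An orthonormal basis of \<open>L\<^sup>2[0,1]\<close> adapted to the wavelet, in the style of Cohen, Daubechies
  and Vial. The set \<open>B\<close> contains the indices of the boundary-adapted functions: at most \<open>C\<close> of them
  per level, living within distance \<open>C 2\<^sup>-\<^sup>j\<close> of the endpoints. All other basis functions are wavelets
  of the line with support in \<open>[0,1]\<close>, and at each level \<open>j \<ge> 0\<close> all but at most \<open>C\<close> of those occur.
  At level \<open>-1\<close> the support of \<open>\<phi>(\<cdot> - k)\<close> is usually not contained in \<open>[0,1]\<close>; the (finitely many)
  scaling functions that have to be modified or rescaled to fit into the interval are also in \<open>B\<close>.\<close>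

definition unit_interval_wavelet_basis ::
    "(real \<Rightarrow> real) \<Rightarrow> (real \<Rightarrow> real) \<Rightarrow> windex set \<Rightarrow> (windex \<Rightarrow> real \<Rightarrow> real) \<Rightarrow> bool" where
  "unit_interval_wavelet_basis \<phi> \<psi> \<Lambda> b \<longleftrightarrow>
     compactly_supported_wavelet \<phi> \<psi> \<and>
     \<Lambda> \<subseteq> {(j, k). j \<ge> -1} \<and>
     orthonormal_basis_L2 (restrict_space lborel {0..1}) b \<Lambda> \<and>
     (\<exists>B\<subseteq>\<Lambda>. \<exists>C::nat.
        (\<forall>j. finite {k. (j, k) \<in> B} \<and> card {k. (j, k) \<in> B} \<le> C) \<and>
        (\<forall>(j, k)\<in>B. \<forall>x\<in>{0..1}. b (j, k) x \<noteq> 0 \<longrightarrow>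
           x \<le> real C * 2 powr - of_int j \<or> 1 - x \<le> real C * 2 powr - of_int j) \<and>
        (\<forall>l\<in>\<Lambda> - B. inside_unit (wavelet_fun \<phi> \<psi> l) \<and>
           (\<forall>x\<in>{0..1}. b l x = wavelet_fun \<phi> \<psi> l x)) \<and>
        (\<forall>j\<ge>0. let missing = {k. inside_unit (wavelet_fun \<phi> \<psi> (j, k)) \<and> (j, k) \<notin> \<Lambda> - B}
           in finite missing \<and> card missing \<le> C))"


definition unit_cube :: "(real ^ 'd) set" where
  "unit_cube = {x. \<forall>r. 0 \<le> x $ r \<and> x $ r \<le> 1}"

abbreviation cube_measure :: "(real ^ 'd) measure" where
  "cube_measure \<equiv> restrict_space lborel unit_cube"

text \<open>The library's \<open>indep_var\<close> needs both variables to have the same type, so independence of the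
  design vector and the noise vector is expressed through their joint law.\<close>

definition regression_design ::
    "nat \<Rightarrow> 'a measure \<Rightarrow> (nat \<Rightarrow> 'a \<Rightarrow> real ^ 'd) \<Rightarrow> (nat \<Rightarrow> 'a \<Rightarrow> real) \<Rightarrow> bool" where
  "regression_design n M X \<epsilon> \<longleftrightarrow>
     prob_space M \<and>
     prob_space.indep_vars M (\<lambda>_. borel) X {..<n} \<and>
     (\<forall>i<n. distr M borel (X i) = uniform_measure lborel unit_cube) \<and>
     prob_space.indep_vars M (\<lambda>_. borel) \<epsilon> {..<n} \<and>
     (\<forall>i<n. distributed M lborel (\<epsilon> i) std_normal_density) \<and>
     (let PX = Pi\<^sub>M {..<n} (\<lambda>_. borel); PE = Pi\<^sub>M {..<n} (\<lambda>_. borel);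
          Xs = (\<lambda>\<omega>. \<lambda>i\<in>{..<n}. X i \<omega>); Es = (\<lambda>\<omega>. \<lambda>i\<in>{..<n}. \<epsilon> i \<omega>)
      in distr M (PX \<Otimes>\<^sub>M PE) (\<lambda>\<omega>. (Xs \<omega>, Es \<omega>)) = distr M PX Xs \<Otimes>\<^sub>M distr M PE Es)"

definition tensor_wavelet ::
    "(windex \<Rightarrow> real \<Rightarrow> real) \<Rightarrow> ('d \<Rightarrow> windex) \<Rightarrow> real ^ 'd \<Rightarrow> real" where
  "tensor_wavelet b l x = (\<Prod>r\<in>UNIV. b (l r) (x $ r))"

definition empirical_coeff ::
    "(windex \<Rightarrow> real \<Rightarrow> real) \<Rightarrow> nat \<Rightarrow> (nat \<Rightarrow> real ^ 'd) \<Rightarrow> (nat \<Rightarrow> real) \<Rightarrow> ('d \<Rightarrow> windex) \<Rightarrow> real" where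
  "empirical_coeff b n xs ys l = 1 / real n * (\<Sum>i<n. ys i * tensor_wavelet b l (xs i))"

text \<open>For infinite \<open>I\<close> the series is understood in \<open>L\<^sup>2([0,1]\<^sup>d)\<close>; the choice of a representative
  is irrelevant for the risk. If it diverges there is no estimate (\<open>None\<close>), and the loss is
  \<open>\<infinity>\<close>, in accordance with Parseval's identity.\<close>

definition wavelet_estimator ::
    "(windex \<Rightarrow> real \<Rightarrow> real) \<Rightarrow> ('d \<Rightarrow> windex) set \<Rightarrow> nat \<Rightarrow> (nat \<Rightarrow> real ^ 'd) \<Rightarrow> (nat \<Rightarrow> real)
     \<Rightarrow> (real ^ 'd \<Rightarrow> real) option" where
  "wavelet_estimator b I n xs ys =
     (let u = (\<lambda>l x. empirical_coeff b n xs ys l * tensor_wavelet b l x)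
      in if finite I then Some (\<lambda>x. \<Sum>l\<in>I. u l x)
         else if \<exists>g. has_sum_L2 cube_measure u I g
         then Some (SOME g. has_sum_L2 cube_measure u I g)
         else None)"

definition sq_loss :: "(real ^ 'd \<Rightarrow> real) option \<Rightarrow> (real ^ 'd \<Rightarrow> real) \<Rightarrow> ennreal" where
  "sq_loss e f0 = (case e of None \<Rightarrow> \<infinity>
                   | Some f \<Rightarrow> \<integral>\<^sup>+x. ennreal ((f x - f0 x)\<^sup>2) \<partial>cube_measure)"

definition risk ::
    "('a measure) \<Rightarrow> (nat \<Rightarrow> 'a \<Rightarrow> real ^ 'd) \<Rightarrow> (nat \<Rightarrow> 'a \<Rightarrow> real)
     \<Rightarrow> ((nat \<Rightarrow> real ^ 'd) \<Rightarrow> (nat \<Rightarrow> real) \<Rightarrow> (real ^ 'd \<Rightarrow> real) option)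
     \<Rightarrow> (real ^ 'd \<Rightarrow> real) \<Rightarrow> ennreal" where
  "risk M X \<epsilon> est f0 =
     (\<integral>\<^sup>+\<omega>. sq_loss (est (\<lambda>i. X i \<omega>) (\<lambda>i. f0 (X i \<omega>) + \<epsilon> i \<omega>)) f0 \<partial>M)"


text \<open>Functions on \<open>[0,D]\<close> are represented by functions on the line whose values outside \<open>[0,D]\<close>
  are irrelevant.\<close>

definition holder_ball :: "real \<Rightarrow> real \<Rightarrow> real \<Rightarrow> (real \<Rightarrow> real) set" where
  "holder_ball \<alpha> D K = {h.
     (SUP u\<in>{0..D}. ennreal \<bar>h u\<bar>) +
     (SUP (u, v)\<in>{(u, v). u \<in> {0..D} \<and> v \<in> {0..D} \<and> u \<noteq> v}.
        ennreal (\<bar>h u - h v\<bar> / \<bar>u - v\<bar> powr \<alpha>)) \<le> ennreal K}"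

definition additive_ridge_class :: "real \<Rightarrow> real \<Rightarrow> (real ^ 'd \<Rightarrow> real) set" where
  "additive_ridge_class \<alpha> K =
     {\<lambda>x. h (\<Sum>r\<in>UNIV. x $ r) | h. h \<in> holder_ball \<alpha> (real CARD('d)) K}"

end

theory Submission imports Defs begin

text \<open>An index in \<open>I\<close> costs variance, an index outside \<open>I\<close> costs squared bias, and a suitable
pair of test functions puts a coefficient of size \<open>n\<^sup>-\<^sup>1\<^sup>/\<^sup>2\<close> on so many indices that either
price, paid that many times, is of the order of the claimed rate.

Let \<open>d\<close> denote the dimension and \<open>d\<^sub>l(f)\<close> the coefficient of \<open>f\<close> at the tensor wavelet \<open>l\<close>. The
tensor wavelets are orthonormal on the cube, so Bessel's inequality bounds the loss below by
the sum, over any finite set \<open>S\<close> of indices, of the squared errors in the coefficients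
(\<open>L2_error_ge_coefficient_errors\<close>). For \<open>l \<notin> I\<close> the error is \<open>d\<^sub>l(f)\<close>. For \<open>l \<in> I\<close> its mean
square is at least \<open>1/n\<close>: conditionally on the design, the noise alone contributes a centred
normal variable with variance \<open>n\<^sup>-\<^sup>2 \<Sum>\<^sub>i \<psi>\<^sub>l(X\<^sub>i)\<^sup>2\<close>, whose expectation is \<open>1/n\<close>
(\<open>mean_square_error_ge_noise\<close>). Hence the risk is at least the sum over \<open>l \<in> S\<close> of \<open>1/n\<close> or
\<open>d\<^sub>l(f)\<^sup>2\<close> (\<open>risk_ge_variance_or_bias\<close>).

For \<open>q = 2\<^sup>j\<close> take the two functions \<open>A q\<^sup>-\<^sup>\<alpha> cos(q \<omega> \<Sum>\<^sub>r x\<^sub>r)\<close> and \<open>A q\<^sup>-\<^sup>\<alpha> sin(q \<omega> \<Sum>\<^sub>r x\<^sub>r)\<close>,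
which lie in the class when \<open>A\<close> is small enough (\<open>rescaled_in_holder_ball\<close>). They are the real
and imaginary part of an exponential that factorizes over the coordinates. If all components of
\<open>l\<close> are interior wavelets of level \<open>j\<close>, the sum of their squared coefficients at \<open>l\<close> is
therefore \<open>A\<^sup>2 q\<^sup>-\<^sup>2\<^sup>\<alpha> q\<^sup>-\<^sup>d \<bar>F \<psi>(\<omega>)\<bar>\<^sup>2\<^sup>d\<close>, where \<open>F \<psi>(\<omega>)\<close> is the Fourier integral of \<open>\<psi>\<close>
(\<open>sq_coefficients_cos_sin\<close>). The location of \<open>l\<close> enters only through a phase, and the phase
cancels because sine and cosine are used together. The frequency \<open>\<omega>\<close> is chosen with \<open>F \<psi>(\<omega>) \<noteq>
0\<close>; it exists because \<open>\<psi>\<close> is integrable and not almost everywhere zero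
(\<open>fourier_transform_nonzero\<close>).

At least half of the \<open>2\<^sup>j\<close> locations of a high level \<open>j\<close> are interior
(\<open>many_interior_wavelets\<close>), so \<open>S\<close> can be taken with at least \<open>(q/2)\<^sup>d\<close> elements. With \<open>q\<close> of
the order \<open>n\<^bsup>1/(2\<alpha>+d)\<^esup>\<close> the sum of the squared coefficients at each of them is of the order
\<open>1/n\<close>, and the two risks together are at least a constant times \<open>q\<^sup>d / n\<close>, which is of the
order \<open>n\<^bsup>-2\<alpha>/(2\<alpha>+d)\<^esup>\<close>. One of the two functions has at least half of that risk; the choice
between them may depend on \<open>I\<close>, but the constant does not.\<close>

section \<open>Coefficients of square-integrable functions\<close>

lemma square_integrable_mult:
  assumes "square_integrable M f" "square_integrable M g"
  shows "integrable M (\<lambda>x. f x * g x)"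
proof (rule Bochner_Integration.integrable_bound)
  show "integrable M (\<lambda>x. (f x)\<^sup>2 + (g x)\<^sup>2)"
    using assms by (simp add: square_integrable_def)
  show "(\<lambda>x. f x * g x) \<in> borel_measurable M"
    using assms by (auto simp: square_integrable_def)
  have "\<bar>u * v\<bar> \<le> u\<^sup>2 + v\<^sup>2" for u v :: real
  proof -
    have "2 * (\<bar>u\<bar> * \<bar>v\<bar>) \<le> u\<^sup>2 + v\<^sup>2"
      using sum_squares_bound[of "\<bar>u\<bar>" "\<bar>v\<bar>"] by simp
    moreover have "0 \<le> \<bar>u\<bar> * \<bar>v\<bar>" by simp
    ultimately show ?thesis unfolding abs_mult by linarith
  qed
  then show "AE x in M. norm (f x * g x) \<le> norm ((f x)\<^sup>2 + (g x)\<^sup>2)"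
    by simp
qed

lemma square_integrable_add:
  assumes "square_integrable M f" "square_integrable M g"
  shows "square_integrable M (\<lambda>x. f x + g x)"
proof -
  have "integrable M (\<lambda>x. (f x)\<^sup>2 + (g x)\<^sup>2 + 2 * (f x * g x))"
    using assms square_integrable_mult[OF assms] by (simp add: square_integrable_def)
  then show ?thesis
    using assms by (auto simp: square_integrable_def power2_sum algebra_simps)
qed

lemma square_integrable_cmult:
  "square_integrable M f \<Longrightarrow> square_integrable M (\<lambda>x. c * f x)"
  by (auto simp: square_integrable_def power_mult_distrib)

lemma square_integrable_diff:
  assumes "square_integrable M f" "square_integrable M g"
  shows "square_integrable M (\<lambda>x. f x - g x)"
  using square_integrable_add[OF assms(1) square_integrable_cmult[OF assms(2), of "-1"]]
  by simp

lemma square_integrable_sum: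
  assumes "\<And>i. i \<in> S \<Longrightarrow> square_integrable M (f i)"
  shows "square_integrable M (\<lambda>x. \<Sum>i\<in>S. f i x)"
  using assms
proof (induction S rule: infinite_finite_induct)
  case (insert i S)
  then show ?case by (simp add: square_integrable_add)
qed (simp_all add: square_integrable_def)

lemma square_integrable_iff_nn_integral:
  "square_integrable M f \<longleftrightarrow>
     f \<in> borel_measurable M \<and> (\<integral>\<^sup>+x. ennreal ((f x)\<^sup>2) \<partial>M) < \<infinity>"
  by (auto simp: square_integrable_def integrable_iff_bounded)

definition orthonormal_L2 :: "'a measure \<Rightarrow> ('i \<Rightarrow> 'a \<Rightarrow> real) \<Rightarrow> 'i set \<Rightarrow> bool" where
  "orthonormal_L2 M e T \<longleftrightarrow> (\<forall>i\<in>T. square_integrable M (e i)) \<and>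
     (\<forall>i\<in>T. \<forall>j\<in>T. (\<integral>x. e i x * e j x \<partial>M) = (if i = j then 1 else 0))"

lemma integral_orthonormal_sum:
  assumes "orthonormal_L2 M e T" "finite F" "F \<subseteq> T" "l \<in> T"
  shows "(\<integral>x. (\<Sum>i\<in>F. c i * e i x) * e l x \<partial>M) = (if l \<in> F then c l else 0)"
proof -
  have int: "integrable M (\<lambda>x. e i x * e l x)" if "i \<in> F" for i
    using assms that by (intro square_integrable_mult) (auto simp: orthonormal_L2_def)
  have "(\<integral>x. (\<Sum>i\<in>F. c i * e i x) * e l x \<partial>M) = (\<integral>x. (\<Sum>i\<in>F. c i * (e i x * e l x)) \<partial>M)"
    by (simp add: sum_distrib_right mult.assoc)
  also have "\<dots> = (\<Sum>i\<in>F. c i * (\<integral>x. e i x * e l x \<partial>M))"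
    using int by (subst Bochner_Integration.integral_sum) auto
  also have "\<dots> = (\<Sum>i\<in>F. if i = l then c i else 0)"
    using assms by (intro sum.cong) (auto simp: orthonormal_L2_def)
  also have "\<dots> = (if l \<in> F then c l else 0)"
    using \<open>finite F\<close> by (simp add: sum.delta)
  finally show ?thesis .
qed

text \<open>Expand \<open>0 \<le> \<parallel>r - p\<parallel>\<^sup>2\<close>, where \<open>p\<close> is the orthogonal projection of \<open>r\<close> onto the span of
the \<open>e\<^sub>l\<close>, \<open>l \<in> S\<close>.\<close>

lemma bessel_inequality:
  assumes e: "orthonormal_L2 M e T" and S: "finite S" "S \<subseteq> T" and r: "square_integrable M r"
  shows "(\<Sum>l\<in>S. (\<integral>x. r x * e l x \<partial>M)\<^sup>2) \<le> (\<integral>x. (r x)\<^sup>2 \<partial>M)"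
proof -
  define a where "a l = (\<integral>x. r x * e l x \<partial>M)" for l
  define p where "p x = (\<Sum>l\<in>S. a l * e l x)" for x
  have se: "square_integrable M (e l)" if "l \<in> S" for l
    using e S that by (auto simp: orthonormal_L2_def)
  have p: "square_integrable M p"
    unfolding p_def using se by (intro square_integrable_sum square_integrable_cmult) auto
  have re: "integrable M (\<lambda>x. r x * e l x)" if "l \<in> S" for l
    using r se[OF that] by (rule square_integrable_mult)
  have pe: "integrable M (\<lambda>x. p x * e l x)" if "l \<in> S" for l
    using p se[OF that] by (rule square_integrable_mult)
  have rp: "(\<integral>x. r x * p x \<partial>M) = (\<Sum>l\<in>S. (a l)\<^sup>2)"
  proof -
    have "(\<integral>x. r x * p x \<partial>M) = (\<integral>x. (\<Sum>l\<in>S. a l * (r x * e l x)) \<partial>M)"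
      by (simp add: p_def sum_distrib_left mult_ac)
    also have "\<dots> = (\<Sum>l\<in>S. a l * a l)"
      using re by (subst Bochner_Integration.integral_sum) (auto simp: a_def)
    finally show ?thesis by (simp add: power2_eq_square)
  qed
  have pp: "(\<integral>x. p x * p x \<partial>M) = (\<Sum>l\<in>S. (a l)\<^sup>2)"
  proof -
    have "(\<integral>x. p x * p x \<partial>M) = (\<integral>x. (\<Sum>l\<in>S. a l * (p x * e l x)) \<partial>M)"
      by (subst (2) p_def) (simp add: sum_distrib_left mult_ac)
    also have "\<dots> = (\<Sum>l\<in>S. a l * (\<integral>x. p x * e l x \<partial>M))"
      using pe by (subst Bochner_Integration.integral_sum) auto
    also have "\<dots> = (\<Sum>l\<in>S. a l * a l)"
      using integral_orthonormal_sum[OF e S] S by (intro sum.cong) (auto simp: p_def)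
    finally show ?thesis by (simp add: power2_eq_square)
  qed
  have "0 \<le> (\<integral>x. (r x - p x)\<^sup>2 \<partial>M)" by simp
  also have "\<dots> = (\<integral>x. (r x)\<^sup>2 - 2 * (r x * p x) + p x * p x \<partial>M)"
    by (simp add: power2_diff power2_eq_square algebra_simps)
  also have "\<dots> = (\<integral>x. (r x)\<^sup>2 \<partial>M) - 2 * (\<integral>x. r x * p x \<partial>M) + (\<integral>x. p x * p x \<partial>M)"
    using square_integrable_mult[OF r p] square_integrable_mult[OF p p] r
    by (simp add: square_integrable_def)
  finally show ?thesis by (simp add: rp pp a_def)
qed

lemma bessel_inequality_nn:
  assumes "orthonormal_L2 M e T" "finite S" "S \<subseteq> T" "square_integrable M r"
  shows "(\<Sum>l\<in>S. ennreal ((\<integral>x. r x * e l x \<partial>M)\<^sup>2)) \<le> (\<integral>\<^sup>+x. ennreal ((r x)\<^sup>2) \<partial>M)"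
proof -
  have "(\<integral>\<^sup>+x. ennreal ((r x)\<^sup>2) \<partial>M) = ennreal (\<integral>x. (r x)\<^sup>2 \<partial>M)"
    using assms by (intro nn_integral_eq_integral) (auto simp: square_integrable_def)
  then show ?thesis
    using bessel_inequality[OF assms] by (simp add: ennreal_leI)
qed

text \<open>Coefficients are continuous in \<open>L\<^sup>2\<close>: Bessel's inequality for the single index \<open>l\<close> bounds
the squared difference between a coefficient of \<open>g\<close> and that of a partial sum by their squared
distance. The coefficient of the partial sum over \<open>F\<close> is constant as soon as \<open>F\<close> contains \<open>l\<close>
whenever \<open>I\<close> does.\<close>

lemma coefficient_of_has_sum_L2:
  assumes e: "orthonormal_L2 M e T" and I: "I \<subseteq> T" and l: "l \<in> T"
    and g: "square_integrable M g" and sum: "has_sum_L2 M (\<lambda>i x. c i * e i x) I g"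
  shows "(\<integral>x. g x * e l x \<partial>M) = (if l \<in> I then c l else 0)"
proof -
  let ?d = "(\<integral>x. g x * e l x \<partial>M) - (if l \<in> I then c l else 0)"
  define N where "N F = (\<integral>\<^sup>+x. ennreal ((g x - (\<Sum>i\<in>F. c i * e i x))\<^sup>2) \<partial>M)" for F
  have el: "square_integrable M (e l)" using e l by (auto simp: orthonormal_L2_def)
  have le: "ennreal (?d\<^sup>2) \<le> N F" if F: "finite F" "{l} \<inter> I \<subseteq> F" "F \<subseteq> I" for F
  proof -
    let ?p = "\<lambda>x. \<Sum>i\<in>F. c i * e i x"
    have p: "square_integrable M ?p"
      using e F I by (intro square_integrable_sum square_integrable_cmult)
        (auto simp: orthonormal_L2_def)
    have "(\<integral>x. (g x - ?p x) * e l x \<partial>M) = (\<integral>x. g x * e l x \<partial>M) - (\<integral>x. ?p x * e l x \<partial>M)"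
      unfolding left_diff_distrib
      using square_integrable_mult[OF g el] square_integrable_mult[OF p el]
      by (rule Bochner_Integration.integral_diff)
    also have "(\<integral>x. ?p x * e l x \<partial>M) = (if l \<in> I then c l else 0)"
      using integral_orthonormal_sum[OF e F(1) _ l, of c] F I by auto
    finally show ?thesis
      using bessel_inequality_nn[OF e _ _ square_integrable_diff[OF g p], of "{l}"] l
      by (simp add: N_def)
  qed
  have "(N \<longlongrightarrow> 0) (finite_subsets_at_top I)"
    using sum by (simp add: has_sum_L2_def N_def[abs_def])
  moreover have "\<forall>\<^sub>F F in finite_subsets_at_top I. ennreal (?d\<^sup>2) \<le> N F"
    unfolding eventually_finite_subsets_at_top
    using le by (intro exI[of _ "{l} \<inter> I"]) blast
  ultimately have "ennreal (?d\<^sup>2) \<le> 0"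
    by (rule tendsto_lowerbound) simp
  then show ?thesis by (simp add: ennreal_eq_0_iff)
qed

text \<open>This is Bessel's inequality for \<open>g - f\<close>. It covers the finite and the infinite index set
\<open>I\<close> at once, and also the degenerate situation where the limit \<open>g\<close> is at infinite distance from
\<open>f\<close>.\<close>

lemma L2_error_ge_coefficient_errors:
  assumes e: "orthonormal_L2 M e T" and I: "I \<subseteq> T" and S: "finite S" "S \<subseteq> T"
    and f: "square_integrable M f" and sum: "has_sum_L2 M (\<lambda>i x. c i * e i x) I g"
  shows "(\<Sum>l\<in>S. ennreal (((if l \<in> I then c l else 0) - (\<integral>x. f x * e l x \<partial>M))\<^sup>2))
           \<le> (\<integral>\<^sup>+x. ennreal ((g x - f x)\<^sup>2) \<partial>M)"
proof (cases "(\<integral>\<^sup>+x. ennreal ((g x - f x)\<^sup>2) \<partial>M) = \<infinity>")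
  case False
  then have r: "square_integrable M (\<lambda>x. g x - f x)"
    using sum f by (auto simp: square_integrable_iff_nn_integral has_sum_L2_def less_top)
  have g: "square_integrable M g"
    using square_integrable_add[OF r f] by simp
  have "(\<integral>x. (g x - f x) * e l x \<partial>M) = (if l \<in> I then c l else 0) - (\<integral>x. f x * e l x \<partial>M)"
    if "l \<in> S" for l
  proof -
    have el: "square_integrable M (e l)" using e that S by (auto simp: orthonormal_L2_def)
    have "(\<integral>x. (g x - f x) * e l x \<partial>M) = (\<integral>x. g x * e l x \<partial>M) - (\<integral>x. f x * e l x \<partial>M)"
      unfolding left_diff_distrib
      using square_integrable_mult[OF g el] square_integrable_mult[OF f el]
      by (rule Bochner_Integration.integral_diff)
    then show ?thesis
      using coefficient_of_has_sum_L2[OF e I _ g sum, of l] that S by auto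
  qed
  then show ?thesis
    using bessel_inequality_nn[OF e S r] by simp
qed simp

lemma has_sum_L2_finite:
  assumes "finite I" "\<And>i. i \<in> I \<Longrightarrow> u i \<in> borel_measurable M"
  shows "has_sum_L2 M u I (\<lambda>x. \<Sum>i\<in>I. u i x)"
  using assms
  by (auto simp: has_sum_L2_def eventually_finite_subsets_at_top_finite intro!: tendsto_eventually)

section \<open>Tensor products on the unit cube\<close>

text \<open>Fubini's theorem for a product of one-variable functions. Lebesgue measure on a Euclidean
space is the image of a product measure indexed by basis vectors, so the factors have to be
reindexed from coordinates to unit vectors. The values may be complex, which is what the
exponential test functions require.\<close>

lemma lborel_vec_prod:
  fixes f :: "'d::finite \<Rightarrow> real \<Rightarrow> 'b :: {real_normed_field, banach, second_countable_topology}"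
  assumes f: "\<And>r. integrable lborel (f r)"
  shows "integrable lborel (\<lambda>x :: real ^ 'd. \<Prod>r\<in>UNIV. f r (x $ r))"
    and "(\<integral>x. (\<Prod>r\<in>UNIV. f r (x $ r)) \<partial>(lborel :: (real ^ 'd) measure))
        = (\<Prod>r\<in>UNIV. \<integral>t. f r t \<partial>lborel)"
proof -
  let ?B = "Basis :: (real ^ 'd) set"
  let ?P = "\<Pi>\<^sub>M b\<in>?B. (lborel :: real measure)"
  let ?T = "\<lambda>g :: real ^ 'd \<Rightarrow> real. \<Sum>b\<in>?B. g b *\<^sub>R b"
  define F where "F b = f (SOME r. b = axis r 1)" for b :: "real ^ 'd"
  have F: "F (axis r 1) = f r" for r
    by (simp add: F_def axis_eq_axis)
  have B: "?B = (\<lambda>r. axis r 1) ` UNIV" by (auto simp: Basis_vec_def)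
  have inj: "inj (\<lambda>r :: 'd. axis r (1 :: real))" by (auto simp: inj_on_def axis_eq_axis)
  have int: "integrable lborel (F b)" if "b \<in> ?B" for b
    using that f by (auto simp: B F)
  interpret product_sigma_finite "\<lambda>b :: real ^ 'd. (lborel :: real measure)" ..
  have coord: "?T g $ r = g (axis r 1)" for g r
    using inner_sum_left_Basis[of "axis r 1" g] by (simp add: inner_axis B)
  have eq: "(\<Prod>r\<in>UNIV. f r (?T g $ r)) = (\<Prod>b\<in>?B. F b (g b))" for g
  proof -
    have "(\<Prod>r\<in>UNIV. f r (?T g $ r)) = (\<Prod>r\<in>UNIV. F (axis r 1) (g (axis r 1)))"
      by (simp only: coord F)
    also have "\<dots> = (\<Prod>b\<in>?B. F b (g b))"
      unfolding B by (subst prod.reindex[OF inj]) simp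
    finally show ?thesis .
  qed
  have meas: "(\<lambda>x :: real ^ 'd. \<Prod>r\<in>UNIV. f r (x $ r)) \<in> borel_measurable borel"
  proof (intro borel_measurable_prod)
    fix r
    have [measurable]: "f r \<in> borel_measurable borel"
      using borel_measurable_integrable[OF f[of r]] by simp
    show "(\<lambda>x :: real ^ 'd. f r (x $ r)) \<in> borel_measurable borel"
      by measurable
  qed
  have T: "?T \<in> measurable ?P borel" by measurable
  show "integrable lborel (\<lambda>x :: real ^ 'd. \<Prod>r\<in>UNIV. f r (x $ r))"
    unfolding lborel_eq[where 'a = "real ^ 'd"]
    unfolding integrable_distr_eq[OF T meas] eq
    by (rule product_integrable_prod) (auto simp: int)
  have "(\<integral>x. (\<Prod>r\<in>UNIV. f r (x $ r)) \<partial>(lborel :: (real ^ 'd) measure)) = (\<integral>g. (\<Prod>b\<in>?B. F b (g b)) \<partial>?P)"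
    unfolding lborel_eq[where 'a = "real ^ 'd"] integral_distr[OF T meas] eq ..
  also have "\<dots> = (\<Prod>b\<in>?B. \<integral>t. F b t \<partial>lborel)"
    by (rule product_integral_prod) (auto simp: int)
  also have "\<dots> = (\<Prod>r\<in>UNIV. \<integral>t. f r t \<partial>lborel)"
    unfolding B by (subst prod.reindex[OF inj]) (simp add: F)
  finally show "(\<integral>x. (\<Prod>r\<in>UNIV. f r (x $ r)) \<partial>(lborel :: (real ^ 'd) measure))
      = (\<Prod>r\<in>UNIV. \<integral>t. f r t \<partial>lborel)" .
qed

abbreviation unit_interval_measure :: "real measure" where
  "unit_interval_measure \<equiv> restrict_space lborel {0..1}"

lemma unit_cube_measurable [measurable]: "unit_cube \<in> sets (borel :: (real ^ 'd) measure)"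
proof -
  have "closed (unit_cube :: (real ^ 'd) set)"
    unfolding unit_cube_def by (intro closed_Collect_all closed_Collect_conj
        closed_Collect_le continuous_intros)
  then show ?thesis by simp
qed

lemma indicator_unit_cube: "indicator unit_cube (x :: real ^ 'd)
    = (\<Prod>r\<in>UNIV. indicator {0..1} (x $ r) :: real)"
  by (auto simp: unit_cube_def indicator_def)

lemma cube_prod:
  fixes f :: "'d::finite \<Rightarrow> real \<Rightarrow> 'b :: {real_normed_field, banach, second_countable_topology}"
  assumes f: "\<And>r. integrable unit_interval_measure (f r)"
  shows "integrable cube_measure (\<lambda>x :: real ^ 'd. \<Prod>r\<in>UNIV. f r (x $ r))"
    and "(\<integral>x. (\<Prod>r\<in>UNIV. f r (x $ r)) \<partial>(cube_measure :: (real ^ 'd) measure))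
        = (\<Prod>r\<in>UNIV. \<integral>t. f r t \<partial>unit_interval_measure)"
proof -
  let ?g = "\<lambda>r t. indicator {0..1} t *\<^sub>R f r t"
  have eq: "indicator unit_cube x *\<^sub>R (\<Prod>r\<in>UNIV. f r (x $ r))
      = (\<Prod>r\<in>UNIV. ?g r (x $ r))" for x :: "real ^ 'd"
    unfolding indicator_unit_cube scaleR_conv_of_real of_real_prod by (rule prod.distrib[symmetric])
  have g: "integrable lborel (?g r)" for r
    using f[of r] by (simp add: integrable_restrict_space)
  show "integrable cube_measure (\<lambda>x :: real ^ 'd. \<Prod>r\<in>UNIV. f r (x $ r))"
    using lborel_vec_prod(1)[of ?g, OF g] by (simp add: integrable_restrict_space eq)
  show "(\<integral>x. (\<Prod>r\<in>UNIV. f r (x $ r)) \<partial>(cube_measure :: (real ^ 'd) measure))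
      = (\<Prod>r\<in>UNIV. \<integral>t. f r t \<partial>unit_interval_measure)"
    using lborel_vec_prod(2)[of ?g, OF g] by (simp add: integral_restrict_space eq)
qed

lemma emeasure_unit_cube: "emeasure lborel (unit_cube :: (real ^ 'd) set) = 1"
proof -
  have 1: "integrable unit_interval_measure (\<lambda>_. 1 :: real)"
    by (simp add: integrable_restrict_space)
  have "measure unit_interval_measure {0..1} = 1"
    by (simp add: measure_restrict_space)
  then have "(\<integral>x. 1 \<partial>(cube_measure :: (real ^ 'd) measure)) = (1::real)"
    using cube_prod(2)[of "\<lambda>_::'d. \<lambda>_. 1 :: real", OF 1] by simp
  moreover have "integrable (cube_measure :: (real ^ 'd) measure) (\<lambda>_. 1 :: real)"
    using cube_prod(1)[of "\<lambda>_::'d. \<lambda>_. 1 :: real", OF 1] by simp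
  ultimately have "(\<integral>\<^sup>+x. ennreal 1 \<partial>(cube_measure :: (real ^ 'd) measure)) = ennreal 1"
    by (subst nn_integral_eq_integral) auto
  then show ?thesis
    by (simp add: emeasure_restrict_space space_restrict_space)
qed

lemma orthonormal_tensor_wavelet:
  assumes b: "orthonormal_L2 unit_interval_measure b \<Lambda>"
  shows "orthonormal_L2 cube_measure (tensor_wavelet b) {l :: 'd::finite \<Rightarrow> windex. \<forall>r. l r \<in> \<Lambda>}"
  unfolding orthonormal_L2_def
proof (intro conjI ballI)
  fix l :: "'d \<Rightarrow> windex" assume l: "l \<in> {l. \<forall>r. l r \<in> \<Lambda>}"
  have sq: "square_integrable unit_interval_measure (b (l r))" for r
    using b l by (auto simp: orthonormal_L2_def)
  have "tensor_wavelet b l \<in> borel_measurable cube_measure"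
    unfolding tensor_wavelet_def[abs_def]
  proof (intro borel_measurable_prod)
    fix r
    have "(\<lambda>x :: real ^ 'd. x $ r) \<in> measurable cube_measure unit_interval_measure"
      by (rule measurable_restrict_space3) (auto simp: unit_cube_def)
    moreover have "b (l r) \<in> borel_measurable unit_interval_measure"
      using sq by (simp add: square_integrable_def)
    ultimately show "(\<lambda>x :: real ^ 'd. b (l r) (x $ r)) \<in> borel_measurable cube_measure"
      by (rule measurable_compose)
  qed
  moreover have "integrable cube_measure (\<lambda>x. (tensor_wavelet b l x)\<^sup>2)"
    unfolding tensor_wavelet_def prod_power_distrib
    by (intro cube_prod(1)) (use sq in \<open>auto simp: square_integrable_def\<close>)
  ultimately show "square_integrable cube_measure (tensor_wavelet b l)"
    by (simp add: square_integrable_def)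
  fix m :: "'d \<Rightarrow> windex" assume m: "m \<in> {l. \<forall>r. l r \<in> \<Lambda>}"
  have "(\<integral>x. tensor_wavelet b l x * tensor_wavelet b m x \<partial>cube_measure)
      = (\<Prod>r\<in>UNIV. \<integral>t. b (l r) t * b (m r) t \<partial>unit_interval_measure)"
    unfolding tensor_wavelet_def prod.distrib[symmetric]
    by (intro cube_prod(2) square_integrable_mult) (use b l m in \<open>auto simp: orthonormal_L2_def\<close>)
  also have "\<dots> = (\<Prod>r\<in>UNIV. if l r = m r then 1 else 0)"
    using b l m by (intro prod.cong) (auto simp: orthonormal_L2_def)
  also have "\<dots> = (if l = m then 1 else 0)"
    by auto
  finally show "(\<integral>x. tensor_wavelet b l x * tensor_wavelet b m x \<partial>cube_measure) = (if l = m then 1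
      else 0)" .
qed

section \<open>The noise contribution to an empirical coefficient\<close>

text \<open>The noise variables are centred, uncorrelated and of variance one, so in the expansion of
the square all the mixed terms have mean zero.\<close>

lemma (in prob_space) second_moment_linear_combination:
  fixes \<epsilon> :: "nat \<Rightarrow> 'a \<Rightarrow> real"
  assumes indep: "indep_vars (\<lambda>_. borel) \<epsilon> {..<n}"
    and std: "\<And>i. i < n \<Longrightarrow> distributed M lborel (\<epsilon> i) std_normal_density"
  shows "(\<integral>\<^sup>+\<omega>. ennreal ((A + (\<Sum>i<n. a i * \<epsilon> i \<omega>))\<^sup>2) \<partial>M) = ennreal (A\<^sup>2 + (\<Sum>i<n. (a i)\<^sup>2))"
proof -
  have m1: "integrable M (\<epsilon> i)" and m1': "expectation (\<epsilon> i) = 0"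
    and m2: "integrable M (\<lambda>\<omega>. (\<epsilon> i \<omega>)\<^sup>2)" and m2': "expectation (\<lambda>\<omega>. (\<epsilon> i \<omega>)\<^sup>2) = 1"
    if "i < n" for i
  proof -
    note d = std[OF that]
    show "integrable M (\<epsilon> i)"
      using distributed_integrable[OF d, of "\<lambda>x. x"] integrable_std_normal_moment[of 1] by simp
    show "expectation (\<epsilon> i) = 0"
      using distributed_integral[OF d, of "\<lambda>x. x"] integral_std_normal_moment_odd[of 0] by simp
    show "integrable M (\<lambda>\<omega>. (\<epsilon> i \<omega>)\<^sup>2)"
      using distributed_integrable[OF d, of "\<lambda>x. x\<^sup>2"] integrable_std_normal_moment[of 2] by simp
    show "expectation (\<lambda>\<omega>. (\<epsilon> i \<omega>)\<^sup>2) = 1"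
      using distributed_integral[OF d, of "\<lambda>x. x\<^sup>2"] integral_std_normal_moment_even[of 1]
      by (simp add: numeral_2_eq_2)
  qed
  have cross: "has_bochner_integral M (\<lambda>\<omega>. \<epsilon> i \<omega> * \<epsilon> j \<omega>) (if i = j then 1 else 0)"
    if i: "i < n" and j: "j < n" for i j
  proof (cases "i = j")
    case True
    then show ?thesis
      using m2[OF i] m2'[OF i] by (simp add: has_bochner_integral_iff power2_eq_square)
  next
    case False
    have "indep_vars (\<lambda>_. borel) \<epsilon> {i, j}"
      using indep_vars_subset[OF indep] i j by auto
    then have "indep_var borel (\<epsilon> i) borel (\<epsilon> j)"
      using indep_vars_prod[of "{j}" i \<epsilon>] False by simp
    from indep_var_integrable[OF this] indep_var_lebesgue_integral[OF this]
    show ?thesis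
      using m1[OF i] m1[OF j] m1'[OF i] False by (simp add: has_bochner_integral_iff)
  qed
  let ?L = "\<lambda>\<omega>. \<Sum>i<n. a i * \<epsilon> i \<omega>"
  have L: "has_bochner_integral M ?L 0"
  proof -
    have "has_bochner_integral M ?L (\<Sum>i<n. a i * 0)"
      by (intro has_bochner_integral_sum has_bochner_integral_mult_right)
        (use m1 m1' in \<open>auto simp: has_bochner_integral_iff\<close>)
    then show ?thesis by simp
  qed
  have LL: "has_bochner_integral M (\<lambda>\<omega>. (?L \<omega>)\<^sup>2) (\<Sum>i<n. (a i)\<^sup>2)"
  proof -
    have "has_bochner_integral M (\<lambda>\<omega>. \<Sum>i<n. \<Sum>j<n. (a i * a j) * (\<epsilon> i \<omega> * \<epsilon> j \<omega>))
        (\<Sum>i<n. \<Sum>j<n. (a i * a j) * (if i = j then 1 else 0))"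
      by (intro has_bochner_integral_sum has_bochner_integral_mult_right cross) auto
    moreover have "(\<Sum>i<n. \<Sum>j<n. (a i * a j) * (if i = j then 1 else 0)) = (\<Sum>i<n. (a i)\<^sup>2)"
      by (intro sum.cong refl) (simp add: power2_eq_square if_distrib sum.delta cong: if_cong)
    moreover have "(\<lambda>\<omega>. \<Sum>i<n. \<Sum>j<n. (a i * a j) * (\<epsilon> i \<omega> * \<epsilon> j \<omega>)) = (\<lambda>\<omega>. (?L \<omega>)\<^sup>2)"
      by (simp add: power2_eq_square sum_product mult_ac)
    ultimately show ?thesis by simp
  qed
  have "has_bochner_integral M (\<lambda>\<omega>. A\<^sup>2 + 2 * A * ?L \<omega> + (?L \<omega>)\<^sup>2) (A\<^sup>2 + 2 * A * 0 + (\<Sum>i<n. (a i)\<^sup>2))"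
    by (intro has_bochner_integral_add has_bochner_integral_mult_right L LL)
      (simp add: has_bochner_integral_iff prob_space)
  then have "has_bochner_integral M (\<lambda>\<omega>. (A + ?L \<omega>)\<^sup>2) (A\<^sup>2 + (\<Sum>i<n. (a i)\<^sup>2))"
    by (simp add: power2_sum algebra_simps)
  then show ?thesis
    by (subst nn_integral_eq_integral) (auto simp: has_bochner_integral_iff)
qed

text \<open>Since the design and the noise are independent, the expectation can be taken over the
noise first, with the design \<open>xs\<close> held fixed. The error is then an affine function of the
noise, with constant term \<open>A xs\<close> and coefficients \<open>e (xs i) / n\<close>; its second moment is at least
the sum of the squares of these coefficients. By the normalization of \<open>e\<close>, this sum has
expectation \<open>n / n\<^sup>2\<close>. The constant term, which contains the bias, only adds its square.\<close>

lemma (in prob_space) mean_square_error_ge_noise: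
  fixes X :: "nat \<Rightarrow> 'a \<Rightarrow> 'x::topological_space" and \<epsilon> :: "nat \<Rightarrow> 'a \<Rightarrow> real"
  assumes X: "\<And>i. i < n \<Longrightarrow> X i \<in> borel_measurable M"
    and indep: "indep_vars (\<lambda>_. borel) \<epsilon> {..<n}"
    and std: "\<And>i. i < n \<Longrightarrow> distributed M lborel (\<epsilon> i) std_normal_density"
    and joint: "distr M (Pi\<^sub>M {..<n} (\<lambda>_. borel) \<Otimes>\<^sub>M Pi\<^sub>M {..<n} (\<lambda>_. borel))
          (\<lambda>\<omega>. (\<lambda>i\<in>{..<n}. X i \<omega>, \<lambda>i\<in>{..<n}. \<epsilon> i \<omega>)) =
        distr M (Pi\<^sub>M {..<n} (\<lambda>_. borel)) (\<lambda>\<omega>. \<lambda>i\<in>{..<n}. X i \<omega>) \<Otimes>\<^sub>M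
        distr M (Pi\<^sub>M {..<n} (\<lambda>_. borel)) (\<lambda>\<omega>. \<lambda>i\<in>{..<n}. \<epsilon> i \<omega>)"
    and [measurable]: "f \<in> borel_measurable borel" "e \<in> borel_measurable borel"
    and norm: "\<And>i. i < n \<Longrightarrow> (\<integral>\<^sup>+\<omega>. ennreal ((e (X i \<omega>))\<^sup>2) \<partial>M) = 1"
    and n: "n \<ge> 1"
  shows "ennreal (1 / real n) \<le>
    (\<integral>\<^sup>+\<omega>. ennreal ((1 / real n * (\<Sum>i<n. (f (X i \<omega>) + \<epsilon> i \<omega>) * e (X i \<omega>)) - d)\<^sup>2) \<partial>M)"
proof -
  let ?PX = "Pi\<^sub>M {..<n} (\<lambda>_. borel :: 'x measure)" and ?PE = "Pi\<^sub>M {..<n} (\<lambda>_. borel :: real measure)"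
  let ?Xs = "\<lambda>\<omega>. \<lambda>i\<in>{..<n}. X i \<omega>" and ?Es = "\<lambda>\<omega>. \<lambda>i\<in>{..<n}. \<epsilon> i \<omega>"
  have eps: "\<epsilon> i \<in> borel_measurable M" if "i < n" for i
    using distributed_measurable[OF std[OF that]] by simp
  have Xs: "?Xs \<in> measurable M ?PX"
    using X by (intro measurable_restrict) auto
  have Es: "?Es \<in> measurable M ?PE"
    using eps by (intro measurable_restrict) auto
  interpret DX: prob_space "distr M ?PX ?Xs" by (rule prob_space_distr[OF Xs])
  interpret DE: prob_space "distr M ?PE ?Es" by (rule prob_space_distr[OF Es])
  define A where "A xs = 1 / real n * (\<Sum>i<n. f (xs i) * e (xs i)) - d" for xs :: "nat \<Rightarrow> 'x"
  define a where "a xs i = 1 / real n * e (xs i)" for xs :: "nat \<Rightarrow> 'x" and i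
  define H where "H = (\<lambda>(xs, es). ennreal ((A xs + (\<Sum>i<n. a xs i * es i))\<^sup>2))"
  have A: "A \<in> borel_measurable ?PX"
    unfolding A_def[abs_def] by measurable
  have a: "(\<lambda>xs. a xs i) \<in> borel_measurable ?PX" if "i < n" for i
  proof -
    have [measurable]: "i \<in> {..<n}" using that by simp
    show ?thesis unfolding a_def by measurable
  qed
  have H: "H \<in> borel_measurable (?PX \<Otimes>\<^sub>M ?PE)"
    unfolding H_def a_def A_def by measurable
  have "ennreal (1 / real n) = ennreal ((1 / real n)\<^sup>2) * of_nat n"
    using n by (simp add: ennreal_of_nat_eq_real_of_nat ennreal_mult[symmetric] power2_eq_square)
  also have "\<dots> = (\<Sum>i<n. ennreal ((1 / real n)\<^sup>2) * (\<integral>\<^sup>+\<omega>. ennreal ((e (X i \<omega>))\<^sup>2) \<partial>M))"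
    by (simp add: norm mult.commute)
  also have "\<dots> = (\<integral>\<^sup>+\<omega>. (\<Sum>i<n. ennreal ((a (?Xs \<omega>) i)\<^sup>2)) \<partial>M)"
  proof -
    have [measurable]: "(\<lambda>\<omega>. e (X i \<omega>)) \<in> borel_measurable M" if "i < n" for i
      using X[OF that] by measurable
    show ?thesis
      by (subst nn_integral_sum)
        (auto simp: a_def power_mult_distrib power_divide ennreal_mult' divide_inverse nn_integral_cmult
          intro!: sum.cong)
  qed
  also have "\<dots> = (\<integral>\<^sup>+xs. (\<Sum>i<n. ennreal ((a xs i)\<^sup>2)) \<partial>distr M ?PX ?Xs)"
    using a by (intro nn_integral_distr[OF Xs, symmetric]) auto
  also have "\<dots> \<le> (\<integral>\<^sup>+xs. (\<integral>\<^sup>+es. H (xs, es) \<partial>distr M ?PE ?Es) \<partial>distr M ?PX ?Xs)"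
  proof (intro nn_integral_mono)
    fix xs assume "xs \<in> space (distr M ?PX ?Xs)"
    then have xs: "xs \<in> space ?PX" by simp
    have "(\<integral>\<^sup>+es. H (xs, es) \<partial>distr M ?PE ?Es) = (\<integral>\<^sup>+\<omega>. H (xs, ?Es \<omega>) \<partial>M)"
      using measurable_Pair2[OF H xs] by (intro nn_integral_distr[OF Es]) simp
    also have "\<dots> = ennreal ((A xs)\<^sup>2 + (\<Sum>i<n. (a xs i)\<^sup>2))"
      using second_moment_linear_combination[OF indep std, of "A xs" "a xs"] by (simp add: H_def)
    finally show "(\<Sum>i<n. ennreal ((a xs i)\<^sup>2)) \<le> (\<integral>\<^sup>+es. H (xs, es) \<partial>distr M ?PE ?Es)"
      by (simp add: ennreal_leI)
  qed
  also have "\<dots> = (\<integral>\<^sup>+z. H z \<partial>(distr M ?PX ?Xs \<Otimes>\<^sub>M distr M ?PE ?Es))"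
    using H by (intro DE.nn_integral_fst) simp
  also have "\<dots> = (\<integral>\<^sup>+\<omega>. H (?Xs \<omega>, ?Es \<omega>) \<partial>M)"
    unfolding joint[symmetric] using Xs Es H by (intro nn_integral_distr) auto
  also have "\<dots> = (\<integral>\<^sup>+\<omega>. ennreal ((1 / real n * (\<Sum>i<n. (f (X i \<omega>) + \<epsilon> i \<omega>) * e (X i \<omega>)) - d)\<^sup>2) \<partial>M)"
    by (simp add: H_def A_def a_def distrib_right sum.distrib sum_distrib_left algebra_simps)
  finally show ?thesis .
qed

section \<open>Risk bound by variance or squared bias\<close>

text \<open>A divergent series has infinite loss, and otherwise the estimate is an \<open>L\<^sup>2\<close> sum of its
series, for finite as well as for infinite \<open>I\<close>.\<close>

lemma sq_loss_ge_coefficient_errors: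
  fixes b :: "windex \<Rightarrow> real \<Rightarrow> real" and I S :: "('d::finite \<Rightarrow> windex) set"
  assumes b: "orthonormal_L2 unit_interval_measure b \<Lambda>"
    and I: "I \<subseteq> {l. \<forall>r. l r \<in> \<Lambda>}" and S: "finite S" "S \<subseteq> {l. \<forall>r. l r \<in> \<Lambda>}"
    and f: "square_integrable cube_measure f"
  shows "(\<Sum>l\<in>S. ennreal (((if l \<in> I then empirical_coeff b n xs ys l else 0)
             - (\<integral>x. f x * tensor_wavelet b l x \<partial>cube_measure))\<^sup>2))
           \<le> sq_loss (wavelet_estimator b I n xs ys) f"
proof -
  let ?u = "\<lambda>l x. empirical_coeff b n xs ys l * tensor_wavelet b l x"
  note e = orthonormal_tensor_wavelet[OF b, where 'd = 'd]
  consider g where "wavelet_estimator b I n xs ys = Some g" "has_sum_L2 cube_measure ?u I g"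
    | "wavelet_estimator b I n xs ys = None"
  proof (cases "finite I")
    case True
    have "has_sum_L2 cube_measure ?u I (\<lambda>x. \<Sum>l\<in>I. ?u l x)"
      using e I by (intro has_sum_L2_finite[OF True] borel_measurable_times borel_measurable_const)
        (auto simp: orthonormal_L2_def square_integrable_def)
    with True that(1) show thesis by (simp add: wavelet_estimator_def)
  next
    case False
    show thesis
    proof (cases "\<exists>g. has_sum_L2 cube_measure ?u I g")
      case True
      then have "has_sum_L2 cube_measure ?u I (SOME g. has_sum_L2 cube_measure ?u I g)"
        by (rule someI_ex)
      with True False that(1) show thesis by (simp add: wavelet_estimator_def)
    next
      case no_sum: False
      with False that(2) show thesis by (simp add: wavelet_estimator_def)
    qed
  qed
  then show ?thesis
  proof cases
    case 1
    then show ?thesis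
      using L2_error_ge_coefficient_errors[OF e I S f 1(2)] by (simp add: sq_loss_def)
  qed (simp add: sq_loss_def)
qed

text \<open>The loss is bounded below by a finite sum of coefficient errors, whose expectations are
then bounded one by one. This finite sum is also what makes the integral manageable: it is a
measurable function of the sample, a fact that is not evident for the loss of an arbitrarily
chosen limit function.\<close>

lemma risk_ge_variance_or_bias:
  fixes b :: "windex \<Rightarrow> real \<Rightarrow> real" and I S :: "('d::finite \<Rightarrow> windex) set"
    and X :: "nat \<Rightarrow> 'a \<Rightarrow> real ^ 'd"
  assumes b: "orthonormal_L2 unit_interval_measure b \<Lambda>"
    and I: "I \<subseteq> {l. \<forall>r. l r \<in> \<Lambda>}" and S: "finite S" "S \<subseteq> {l. \<forall>r. l r \<in> \<Lambda>}"
    and f: "square_integrable cube_measure f" and fm: "f \<in> borel_measurable borel"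
    and design: "regression_design n M X \<epsilon>" and n: "n \<ge> 1"
  shows "(\<Sum>l\<in>S. if l \<in> I then ennreal (1 / real n)
             else ennreal ((\<integral>x. f x * tensor_wavelet b l x \<partial>cube_measure)\<^sup>2))
           \<le> risk M X \<epsilon> (wavelet_estimator b I n) f"
proof -
  interpret prob_space M using design by (simp add: regression_design_def)
  have indepX: "indep_vars (\<lambda>_. borel) X {..<n}"
    and law: "\<And>i. i < n \<Longrightarrow> distr M borel (X i) = uniform_measure lborel unit_cube"
    and indep: "indep_vars (\<lambda>_. borel) \<epsilon> {..<n}"
    and std: "\<And>i. i < n \<Longrightarrow> distributed M lborel (\<epsilon> i) std_normal_density"
    and joint: "distr M (Pi\<^sub>M {..<n} (\<lambda>_. borel) \<Otimes>\<^sub>M Pi\<^sub>M {..<n} (\<lambda>_. borel))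
          (\<lambda>\<omega>. (\<lambda>i\<in>{..<n}. X i \<omega>, \<lambda>i\<in>{..<n}. \<epsilon> i \<omega>)) =
        distr M (Pi\<^sub>M {..<n} (\<lambda>_. borel)) (\<lambda>\<omega>. \<lambda>i\<in>{..<n}. X i \<omega>) \<Otimes>\<^sub>M
        distr M (Pi\<^sub>M {..<n} (\<lambda>_. borel)) (\<lambda>\<omega>. \<lambda>i\<in>{..<n}. \<epsilon> i \<omega>)"
    using design by (auto simp: regression_design_def Let_def)
  have X: "X i \<in> borel_measurable M" if "i < n" for i
    using indepX that by (auto simp: indep_vars_def)
  have eps: "\<epsilon> i \<in> borel_measurable M" if "i < n" for i
    using indep that by (auto simp: indep_vars_def)
  note e = orthonormal_tensor_wavelet[OF b, where 'd = 'd]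
  \<comment> \<open>The basis functions are measurable on the cube only. Setting them to zero
    elsewhere makes them Borel functions on the whole space and changes nothing at the design
    points, which lie in the cube almost surely.\<close>
  define e' where "e' l x = indicator unit_cube x * tensor_wavelet b l x" for l and x :: "real ^ 'd"
  define d where "d l = (\<integral>x. f x * tensor_wavelet b l x \<partial>cube_measure)" for l
  define D where "D l \<omega> = (if l \<in> I then 1 / real n * (\<Sum>i<n. (f (X i \<omega>) + \<epsilon> i \<omega>) * e' l (X i \<omega>))
      else 0)"
    for l \<omega>
  have e'm: "e' l \<in> borel_measurable borel" if "l \<in> S" for l
  proof -
    have "tensor_wavelet b l \<in> borel_measurable (cube_measure :: (real ^ 'd) measure)"
      using e S that by (auto simp: orthonormal_L2_def square_integrable_def)
    then show ?thesis
      by (simp add: borel_measurable_restrict_space_iff e'_def[abs_def])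
  qed
  have norm: "(\<integral>\<^sup>+\<omega>. ennreal ((e' l (X i \<omega>))\<^sup>2) \<partial>M) = 1" if l: "l \<in> S" and i: "i < n" for l i
  proof -
    note [measurable] = e'm[OF l]
    have sq: "integrable cube_measure (\<lambda>x. (tensor_wavelet b l x)\<^sup>2)"
      and one: "(\<integral>x. (tensor_wavelet b l x)\<^sup>2 \<partial>cube_measure) = 1"
      using e S l by (auto simp: orthonormal_L2_def square_integrable_def power2_eq_square)
    have "(\<integral>\<^sup>+\<omega>. ennreal ((e' l (X i \<omega>))\<^sup>2) \<partial>M) = (\<integral>\<^sup>+x. ennreal ((e' l x)\<^sup>2) \<partial>distr M borel (X i))"
      using X[OF i] by (intro nn_integral_distr[symmetric]) auto
    also have "\<dots> = (\<integral>\<^sup>+x. ennreal ((e' l x)\<^sup>2) * indicator unit_cube x \<partial>lborel)"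
      unfolding law[OF i] by (subst nn_integral_uniform_measure)
          (auto simp: emeasure_unit_cube divide_ennreal_def)
    also have "\<dots> = (\<integral>\<^sup>+x. ennreal ((tensor_wavelet b l x)\<^sup>2) \<partial>cube_measure)"
      by (subst nn_integral_restrict_space)
        (auto intro!: nn_integral_cong simp: e'_def indicator_def)
    also have "\<dots> = 1"
      by (subst nn_integral_eq_integral[OF sq]) (auto simp: one)
    finally show ?thesis .
  qed
  have D: "D l \<in> borel_measurable M" if l: "l \<in> S" for l
  proof -
    have "(\<lambda>\<omega>. (f (X i \<omega>) + \<epsilon> i \<omega>) * e' l (X i \<omega>)) \<in> borel_measurable M" if i: "i < n" for i
    proof -
      note [measurable] = e'm[OF l] X[OF i] eps[OF i] fm
      show ?thesis by measurable
    qed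
    then show ?thesis by (auto simp: D_def[abs_def])
  qed
  have inside: "AE \<omega> in M. \<forall>i<n. X i \<omega> \<in> unit_cube"
  proof (subst AE_all_countable, intro allI)
    fix i
    show "AE \<omega> in M. i < n \<longrightarrow> X i \<omega> \<in> unit_cube"
    proof (cases "i < n")
      case True
      have "AE x in distr M borel (X i). x \<in> unit_cube"
        unfolding law[OF True] by (rule AE_uniform_measureI) auto
      then show ?thesis
        using X[OF True] by (subst (asm) AE_distr_iff) auto
    qed simp
  qed
  have "(\<Sum>l\<in>S. if l \<in> I then ennreal (1 / real n) else ennreal ((d l)\<^sup>2))
      \<le> (\<Sum>l\<in>S. \<integral>\<^sup>+\<omega>. ennreal ((D l \<omega> - d l)\<^sup>2) \<partial>M)"
  proof (intro sum_mono)
    fix l assume l: "l \<in> S"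
    show "(if l \<in> I then ennreal (1 / real n) else ennreal ((d l)\<^sup>2))
      \<le> (\<integral>\<^sup>+\<omega>. ennreal ((D l \<omega> - d l)\<^sup>2) \<partial>M)"
    proof (cases "l \<in> I")
      case True
      then show ?thesis
        using mean_square_error_ge_noise[OF X indep std joint fm e'm[OF l] norm[OF l] n, of "d l"]
        by (simp add: D_def)
    next
      case False
      then show ?thesis by (simp add: D_def emeasure_space_1)
    qed
  qed
  also have "\<dots> = (\<integral>\<^sup>+\<omega>. (\<Sum>l\<in>S. ennreal ((D l \<omega> - d l)\<^sup>2)) \<partial>M)"
    using D by (intro nn_integral_sum[symmetric]) auto
  also have "\<dots> \<le> risk M X \<epsilon> (wavelet_estimator b I n) f"
    unfolding risk_def
  proof (rule nn_integral_mono_AE)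
    show "AE \<omega> in M. (\<Sum>l\<in>S. ennreal ((D l \<omega> - d l)\<^sup>2)) \<le>
        sq_loss (wavelet_estimator b I n (\<lambda>i. X i \<omega>) (\<lambda>i. f (X i \<omega>) + \<epsilon> i \<omega>)) f"
      using inside
    proof eventually_elim
      case (elim \<omega>)
      then have "D l \<omega> = (if l \<in> I then empirical_coeff b n (\<lambda>i. X i \<omega>) (\<lambda>i. f (X i \<omega>) + \<epsilon> i \<omega>) l
          else 0)" for l
        by (auto simp: D_def empirical_coeff_def e'_def intro!: sum.cong)
      then show ?case
        using sq_loss_ge_coefficient_errors[OF b I S f] by (simp add: d_def)
    qed
  qed
  finally show ?thesis unfolding d_def .
qed

section \<open>Oscillating test functions\<close>

text \<open>If the Fourier integral vanished identically, then the positive and the negative part of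
\<open>f\<close>, normalized to probability densities, would have the same characteristic function. By
Levy's uniqueness theorem the two parts would agree almost everywhere; as their product is
zero, both would vanish.\<close>

lemma fourier_transform_nonzero:
  fixes f :: "real \<Rightarrow> real"
  assumes f: "integrable lborel f" and nz: "\<not> (AE x in lborel. f x = 0)"
  shows "\<exists>\<omega>. (\<integral>x. iexp (\<omega> * x) * complex_of_real (f x) \<partial>lborel) \<noteq> 0"
proof (rule ccontr)
  assume "\<not> ?thesis"
  then have zero: "(\<integral>x. iexp (\<omega> * x) * complex_of_real (f x) \<partial>lborel) = 0" for \<omega> by blast
  define p where "p x = max (f x) 0" for x
  define q where "q x = max (- f x) 0" for x
  have fpq: "f x = p x - q x" for x by (simp add: p_def q_def)
  have p0: "p x \<ge> 0" and q0: "q x \<ge> 0" for x by (simp_all add: p_def q_def)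
  have p: "integrable lborel p" and q: "integrable lborel q"
    using f by (simp_all add: p_def[abs_def] q_def[abs_def] integrable_max)
  note [measurable] = borel_measurable_integrable[OF p] borel_measurable_integrable[OF q]
  have "(\<integral>x. complex_of_real (f x) \<partial>lborel) = 0" using zero[of 0] by simp
  then have "(\<integral>x. f x \<partial>lborel) = 0" by (simp add: integral_complex_of_real)
  then have eq: "(\<integral>x. q x \<partial>lborel) = (\<integral>x. p x \<partial>lborel)"
    using p q by (simp add: fpq)
  define m where "m = (\<integral>x. p x \<partial>lborel)"
  show False
  proof (cases "m = 0")
    case True
    have "AE x in lborel. p x = 0"
      using True integral_nonneg_eq_0_iff_AE[OF p] p0 by (simp add: m_def)
    moreover have "AE x in lborel. q x = 0"
      using True eq integral_nonneg_eq_0_iff_AE[OF q] q0 by (simp add: m_def)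
    ultimately have "AE x in lborel. f x = 0" by eventually_elim (simp add: fpq)
    with nz show False by simp
  next
    case False
    then have m: "m > 0"
      using Bochner_Integration.integral_nonneg[of lborel p] p0 by (auto simp: m_def less_le)
    define D where "D g = density lborel (\<lambda>x. ennreal (g x / m))" for g :: "real \<Rightarrow> real"
    have dist: "real_distribution (D g)"
      if g: "integrable lborel g" "\<And>x. g x \<ge> 0" and gm: "(\<integral>x. g x \<partial>lborel) = m" for g
    proof -
      note [measurable] = borel_measurable_integrable[OF g(1)]
      have "emeasure (D g) (space (D g)) = (\<integral>\<^sup>+x. ennreal (g x / m) \<partial>lborel)"
        by (simp add: D_def emeasure_density)
      also have "\<dots> = 1"
        using g m gm by (subst nn_integral_eq_integral) auto
      finally have "prob_space (D g)" by (rule prob_spaceI)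
      then show ?thesis
        by (simp add: real_distribution_def real_distribution_axioms_def D_def)
    qed
    have char: "char (D g) t = (\<integral>x. iexp (t * x) * complex_of_real (g x) \<partial>lborel) / m"
      if g: "integrable lborel g" "\<And>x. g x \<ge> 0" for g t
    proof -
      note [measurable] = borel_measurable_integrable[OF g(1)]
      have "char (D g) t = (\<integral>x. (g x / m) *\<^sub>R iexp (t * x) \<partial>lborel)"
        unfolding char_def D_def using g m by (intro integral_density) auto
      also have "\<dots> = (\<integral>x. iexp (t * x) * complex_of_real (g x) / complex_of_real m \<partial>lborel)"
        by (simp add: scaleR_conv_of_real mult.commute)
      finally show ?thesis by simp
    qed
    have "char (D p) = char (D q)"
    proof
      fix t
      have int: "integrable lborel (\<lambda>x. iexp (t * x) * complex_of_real (g x))"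
        if "integrable lborel g" for g :: "real \<Rightarrow> real"
        by (rule Bochner_Integration.integrable_bound[OF that])
          (use borel_measurable_integrable[OF that] in \<open>auto simp: norm_mult\<close>)
      have "(\<integral>x. iexp (t * x) * complex_of_real (p x) \<partial>lborel)
          - (\<integral>x. iexp (t * x) * complex_of_real (q x) \<partial>lborel)
          = (\<integral>x. iexp (t * x) * complex_of_real (f x) \<partial>lborel)"
        using Bochner_Integration.integral_diff[OF int[OF p] int[OF q]]
        by (simp add: fpq right_diff_distrib del: of_real_mult)
      then show "char (D p) t = char (D q) t"
        using zero[of t] by (simp add: char p q p0 q0)
    qed
    then have "D p = D q"
      using dist[OF p p0] dist[OF q q0] eq by (intro Levy_uniqueness) (auto simp: m_def)
    then have "AE x in lborel. ennreal (p x / m) = ennreal (q x / m)"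
      unfolding D_def by (subst (asm)
          sigma_finite_measure.density_unique_iff[OF sigma_finite_lborel]) auto
    then have "AE x in lborel. f x = 0"
      by eventually_elim (use m p0 q0 in \<open>auto simp: fpq\<close>)
    with nz show False by simp
  qed
qed

lemma compact_support_square_integrable_imp_integrable:
  fixes f :: "real \<Rightarrow> real"
  assumes f: "square_integrable lborel f" and supp: "\<And>x. f x \<noteq> 0 \<Longrightarrow> \<bar>x\<bar> \<le> L"
  shows "integrable lborel f"
proof (rule Bochner_Integration.integrable_bound)
  show "integrable lborel (\<lambda>x. (f x)\<^sup>2 + indicator {-L..L} x)"
    using f
    by (intro Bochner_Integration.integrable_add integrable_real_indicator)
      (auto simp: square_integrable_def emeasure_lborel_Icc_eq)
  show "f \<in> borel_measurable lborel" using f by (simp add: square_integrable_def)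
  have "\<bar>f x\<bar> \<le> (f x)\<^sup>2 + indicator {-L..L} x" for x
  proof (cases "f x = 0")
    case False
    have "0 \<le> (\<bar>f x\<bar> - 1)\<^sup>2 + \<bar>f x\<bar>" by simp
    also have "\<dots> = (f x)\<^sup>2 + 1 - \<bar>f x\<bar>" by (simp add: power2_diff)
    finally show ?thesis using supp[OF False] by (auto simp: indicator_def abs_le_iff)
  qed simp
  then show "AE x in lborel. norm (f x) \<le> norm ((f x)\<^sup>2 + indicator {-L..L} x)"
    by simp
qed

text \<open>Substituting \<open>y = q x - k\<close> turns the integral into the Fourier integral of \<open>\<psi>\<close> at \<open>\<omega>\<close>, up
to the factor \<open>q\<^sup>-\<^sup>1\<^sup>/\<^sup>2\<close> and the phase \<open>exp(i \<omega> k)\<close>, which has modulus one.\<close>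

lemma sq_norm_fourier_wavelet:
  fixes \<psi> :: "real \<Rightarrow> real" and \<beta> :: "real \<Rightarrow> real"
  assumes j: "j \<ge> 0" and q: "q = 2 powr of_int j"
    and inside: "inside_unit (wavelet_fun \<phi> \<psi> (j, k))"
    and \<beta>: "\<And>x. x \<in> {0..1} \<Longrightarrow> \<beta> x = wavelet_fun \<phi> \<psi> (j, k) x"
  shows "(cmod (\<integral>x. iexp (q * \<omega> * x) * complex_of_real (\<beta> x) \<partial>unit_interval_measure))\<^sup>2
      = (cmod (\<integral>x. iexp (\<omega> * x) * complex_of_real (\<psi> x) \<partial>lborel))\<^sup>2 / q"
proof -
  have q0: "q > 0" by (simp add: q)
  let ?w = "wavelet_fun \<phi> \<psi> (j, k)"
  let ?G = "\<lambda>y. iexp (\<omega> * y) * complex_of_real (\<psi> y)"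
  have out: "?w x = 0" if "x \<notin> {0..1}" for x
    using inside that closure_subset[of "{x. ?w x \<noteq> 0}"] unfolding inside_unit_def by blast
  have w: "?w x = sqrt q * \<psi> (- of_int k + q * x)" for x
    using j by (simp add: q powr_half_sqrt[symmetric] powr_powr algebra_simps)
  have "(\<integral>x. iexp (q * \<omega> * x) * complex_of_real (\<beta> x) \<partial>unit_interval_measure)
      = (\<integral>x. iexp (q * \<omega> * x) * complex_of_real (?w x) \<partial>lborel)"
    by (subst integral_restrict_space)
      (auto simp: \<beta> out indicator_def simp del: wavelet_fun.simps
          intro!: Bochner_Integration.integral_cong)
  also have "\<dots> = (\<integral>x. (sqrt q * iexp (\<omega> * of_int k)) * ?G (- of_int k + q * x) \<partial>lborel)"
    unfolding w by (intro Bochner_Integration.integral_cong)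
      (auto simp: algebra_simps exp_add[symmetric])
  also have "\<dots> = (sqrt q * iexp (\<omega> * of_int k)) * (\<integral>x. ?G (- of_int k + q * x) \<partial>lborel)"
    by (rule integral_mult_right_zero)
  also have "(\<integral>x. ?G (- of_int k + q * x) \<partial>lborel) = (\<integral>x. ?G x \<partial>lborel) / q"
    using lborel_integral_real_affine[of q ?G "- of_int k"] q0
    by (simp add: scaleR_conv_of_real del: of_real_mult)
  finally show ?thesis
    using q0 by (simp add: norm_mult norm_divide power_mult_distrib power_divide)
      (simp add: power2_eq_square)
qed

text \<open>Cosine and sine of \<open>q \<omega> \<Sum>\<^sub>r x\<^sub>r\<close> are the real and the imaginary part of \<open>\<Prod>\<^sub>r exp(i q \<omega>
x\<^sub>r)\<close>. The two squared coefficients add up to the squared modulus of an integral that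
factorizes over the coordinates.\<close>

lemma sq_coefficients_cos_sin:
  fixes \<psi> :: "real \<Rightarrow> real" and b :: "windex \<Rightarrow> real \<Rightarrow> real" and k :: "'d::finite \<Rightarrow> int"
  assumes j: "j \<ge> 0" and q: "q = 2 powr of_int j"
    and inside: "\<And>r. inside_unit (wavelet_fun \<phi> \<psi> (j, k r))"
    and b: "\<And>r x. x \<in> {0..1} \<Longrightarrow> b (j, k r) x = wavelet_fun \<phi> \<psi> (j, k r) x"
    and int: "\<And>r. integrable unit_interval_measure (b (j, k r))"
  shows "(\<integral>x. cos (q * \<omega> * (\<Sum>r\<in>UNIV. x $ r)) * tensor_wavelet b (\<lambda>r. (j, k r)) x \<partial>cube_measure)\<^sup>2 +
      (\<integral>x. sin (q * \<omega> * (\<Sum>r\<in>UNIV. x $ r)) * tensor_wavelet b (\<lambda>r. (j, k r)) x \<partial>cube_measure)\<^sup>2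
      = ((cmod (\<integral>x. iexp (\<omega> * x) * complex_of_real (\<psi> x) \<partial>lborel))\<^sup>2 / q) ^ CARD('d)"
proof -
  let ?F = "\<lambda>r x. iexp (q * \<omega> * x) * complex_of_real (b (j, k r) x)"
  let ?P = "\<lambda>x :: real ^ 'd. \<Prod>r\<in>UNIV. ?F r (x $ r)"
  have F: "integrable unit_interval_measure (?F r)" for r
  proof (rule Bochner_Integration.integrable_bound[OF int[of r]])
    have "(\<lambda>x. complex_of_real (b (j, k r) x)) \<in> borel_measurable unit_interval_measure"
      using borel_measurable_integrable[OF int[of r]] by measurable
    moreover have "(\<lambda>x. iexp (q * \<omega> * x)) \<in> borel_measurable unit_interval_measure"
      by (intro measurable_restrict_space1) simp
    ultimately show "?F r \<in> borel_measurable unit_interval_measure"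
      by (intro borel_measurable_times)
  qed (simp add: norm_mult)
  have P: "?P x = iexp (q * \<omega> * (\<Sum>r\<in>UNIV. x $ r))
      * complex_of_real (tensor_wavelet b (\<lambda>r. (j, k r)) x)" for x
    by (simp add: prod.distrib tensor_wavelet_def exp_sum[symmetric] sum_distrib_left)
  have Re: "(\<integral>x. cos (q * \<omega> * (\<Sum>r\<in>UNIV. x $ r)) * tensor_wavelet b (\<lambda>r. (j, k r)) x \<partial>cube_measure)
      = Re (\<integral>x. ?P x \<partial>cube_measure)"
    unfolding integral_Re[OF cube_prod(1)[of ?F, OF F], symmetric]
    by (simp add: P Re_exp del: of_real_mult)
  have Im: "(\<integral>x. sin (q * \<omega> * (\<Sum>r\<in>UNIV. x $ r)) * tensor_wavelet b (\<lambda>r. (j, k r)) x \<partial>cube_measure)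
      = Im (\<integral>x. ?P x \<partial>cube_measure)"
    unfolding integral_Im[OF cube_prod(1)[of ?F, OF F], symmetric]
    by (simp add: P Im_exp del: of_real_mult)
  have "(cmod (\<integral>x. ?P x \<partial>cube_measure))\<^sup>2 = (\<Prod>r\<in>UNIV. (cmod (\<integral>x. ?F r x \<partial>unit_interval_measure))\<^sup>2)"
    unfolding cube_prod(2)[of ?F, OF F] by (simp add: prod_norm[symmetric] prod_power_distrib)
  also have "\<dots> = (\<Prod>r\<in>(UNIV::'d set). (cmod (\<integral>x. iexp (\<omega> * x) * complex_of_real (\<psi> x) \<partial>lborel))\<^sup>2 / q)"
    by (intro prod.cong refl sq_norm_fourier_wavelet[OF j q inside b])
  finally show ?thesis
    unfolding Re Im cmod_power2[symmetric] by simp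
qed

text \<open>A function bounded by one and with Lipschitz constant one satisfies \<open>\<bar>g s - g t\<bar> \<le> 2 \<bar>s -
t\<bar>\<^sup>\<alpha>\<close>: the Lipschitz bound serves for \<open>\<bar>s - t\<bar> \<le> 1\<close> and the sup bound for \<open>\<bar>s - t\<bar> > 1\<close>.
Rescaling the argument by \<open>q \<omega>\<close> multiplies this bound by \<open>(q \<bar>\<omega>\<bar>)\<^sup>\<alpha>\<close>, and the amplitude \<open>q\<^sup>-\<^sup>\<alpha>\<close>
cancels the power of \<open>q\<close>.\<close>

lemma rescaled_in_holder_ball:
  fixes g :: "real \<Rightarrow> real"
  assumes g: "\<And>s. \<bar>g s\<bar> \<le> 1" and lip: "\<And>s t. \<bar>g s - g t\<bar> \<le> \<bar>s - t\<bar>"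
    and \<alpha>: "0 < \<alpha>" "\<alpha> \<le> 1" and q: "q \<ge> 1" and A: "A \<ge> 0" "A * (1 + 2 * \<bar>\<omega>\<bar> powr \<alpha>) \<le> K"
  shows "(\<lambda>u. A * q powr - \<alpha> * g (q * \<omega> * u)) \<in> holder_ball \<alpha> D K"
proof -
  let ?h = "\<lambda>u. A * q powr - \<alpha> * g (q * \<omega> * u)"
  have "q powr - \<alpha> \<le> q powr 0" using q \<alpha> by (intro powr_mono) auto
  then have q1: "q powr - \<alpha> \<le> 1" using q by simp
  have sup: "\<bar>?h u\<bar> \<le> A" for u
  proof -
    have "A * q powr - \<alpha> * \<bar>g (q * \<omega> * u)\<bar> \<le> A * 1 * 1"
      using g q1 A by (intro mult_mono) auto
    then show ?thesis using A by (simp add: abs_mult)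
  qed
  have gh: "\<bar>g s - g t\<bar> \<le> 2 * \<bar>s - t\<bar> powr \<alpha>" for s t
  proof (cases "\<bar>s - t\<bar> \<le> 1")
    case True
    have "\<bar>g s - g t\<bar> \<le> \<bar>s - t\<bar> powr \<alpha>"
    proof (cases "s = t")
      case False
      then have "\<bar>s - t\<bar> powr 1 \<le> \<bar>s - t\<bar> powr \<alpha>"
        using True \<alpha> by (intro powr_mono') auto
      then show ?thesis using lip[of s t] False by simp
    qed simp
    also have "\<dots> \<le> 2 * \<bar>s - t\<bar> powr \<alpha>" by simp
    finally show ?thesis .
  next
    case False
    then have "1 \<le> \<bar>s - t\<bar> powr \<alpha>" using \<alpha> by (intro ge_one_powr_ge_zero) auto
    then show ?thesis using g[of s] g[of t] by linarith
  qed
  have hoelder: "\<bar>?h u - ?h v\<bar> / \<bar>u - v\<bar> powr \<alpha> \<le> A * (2 * \<bar>\<omega>\<bar> powr \<alpha>)" if "u \<noteq> v" for u v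
  proof -
    have "\<bar>?h u - ?h v\<bar> = A * q powr - \<alpha> * \<bar>g (q * \<omega> * u) - g (q * \<omega> * v)\<bar>"
      using A by (simp add: abs_mult flip: right_diff_distrib)
    also have "\<dots> \<le> A * q powr - \<alpha> * (2 * \<bar>q * \<omega> * u - q * \<omega> * v\<bar> powr \<alpha>)"
      using A by (intro mult_left_mono gh) auto
    also have "\<bar>q * \<omega> * u - q * \<omega> * v\<bar> = q * (\<bar>\<omega>\<bar> * \<bar>u - v\<bar>)"
      using q by (simp add: abs_mult flip: right_diff_distrib)
    also have "(q * (\<bar>\<omega>\<bar> * \<bar>u - v\<bar>)) powr \<alpha> = q powr \<alpha> * (\<bar>\<omega>\<bar> powr \<alpha> * \<bar>u - v\<bar> powr \<alpha>)"
      using q by (simp add: powr_mult)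
    also have "A * q powr - \<alpha> * (2 * (q powr \<alpha> * (\<bar>\<omega>\<bar> powr \<alpha> * \<bar>u - v\<bar> powr \<alpha>)))
        = A * (2 * \<bar>\<omega>\<bar> powr \<alpha>) * \<bar>u - v\<bar> powr \<alpha>"
      using q by (simp add: powr_minus field_simps)
    finally show ?thesis using that by (simp add: divide_le_eq)
  qed
  have "(SUP u\<in>{0..D}. ennreal \<bar>?h u\<bar>) +
     (SUP (u, v)\<in>{(u, v). u \<in> {0..D} \<and> v \<in> {0..D} \<and> u \<noteq> v}. ennreal (\<bar>?h u - ?h v\<bar> / \<bar>u - v\<bar> powr \<alpha>))
      \<le> ennreal A + ennreal (A * (2 * \<bar>\<omega>\<bar> powr \<alpha>))"
  proof (intro add_mono SUP_least)
    show "ennreal \<bar>?h u\<bar> \<le> ennreal A" for u using sup[of u] by (rule ennreal_leI)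
    fix z assume "z \<in> {(u, v). u \<in> {0..D} \<and> v \<in> {0..D} \<and> u \<noteq> v}"
    then show "(case z of (u, v) \<Rightarrow> ennreal (\<bar>?h u - ?h v\<bar> / \<bar>u - v\<bar> powr \<alpha>))
        \<le> ennreal (A * (2 * \<bar>\<omega>\<bar> powr \<alpha>))"
      using hoelder by (auto intro!: ennreal_leI)
  qed
  also have "\<dots> = ennreal (A * (1 + 2 * \<bar>\<omega>\<bar> powr \<alpha>))"
    using A by (simp add: ennreal_plus[symmetric] distrib_left del: ennreal_plus)
  also have "\<dots> \<le> ennreal K" using A by (intro ennreal_leI)
  finally show ?thesis by (simp add: holder_ball_def)
qed

section \<open>The lower bound\<close>

text \<open>If \<open>\<psi>\<close> vanishes outside \<open>[-L, L]\<close>, every wavelet of level \<open>j\<close> with location in \<open>[L, 2\<^sup>j -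
L]\<close> has its support in the unit interval, and all but \<open>C\<close> of these belong to the basis. The
loss of \<open>2 L + C\<close> locations is at most half of \<open>2\<^sup>j\<close> as soon as \<open>j \<ge> 4 L + 2 C\<close>, because \<open>2\<^sup>j >
j\<close>.\<close>

lemma many_interior_wavelets:
  assumes basis: "unit_interval_wavelet_basis \<phi> \<psi> \<Lambda> b"
  shows "\<exists>j0. \<forall>j\<ge>j0. \<exists>Ks. finite Ks \<and> 2 ^ j / 2 \<le> real (card Ks) \<and>
    (\<forall>k\<in>Ks. (int j, k) \<in> \<Lambda> \<and> inside_unit (wavelet_fun \<phi> \<psi> (int j, k)) \<and>
      (\<forall>x\<in>{0..1}. b (int j, k) x = wavelet_fun \<phi> \<psi> (int j, k) x))"
proof -
  obtain B and C :: nat where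
    interior: "\<forall>l\<in>\<Lambda> - B. inside_unit (wavelet_fun \<phi> \<psi> l) \<and>
        (\<forall>x\<in>{0..1}. b l x = wavelet_fun \<phi> \<psi> l x)"
    and missing: "\<forall>j\<ge>0.
        finite {k. inside_unit (wavelet_fun \<phi> \<psi> (j, k)) \<and> (j, k) \<notin> \<Lambda> - B} \<and>
        card {k. inside_unit (wavelet_fun \<phi> \<psi> (j, k)) \<and> (j, k) \<notin> \<Lambda> - B} \<le> C"
    using basis unfolding unit_interval_wavelet_basis_def Let_def by blast
  have "bounded (closure {x. \<psi> x \<noteq> 0})"
    using basis by (auto simp: unit_interval_wavelet_basis_def compactly_supported_wavelet_def
        compact_imp_bounded)
  then obtain R where R: "\<And>x. \<psi> x \<noteq> 0 \<Longrightarrow> \<bar>x\<bar> \<le> R"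
    using closure_subset[of "{x. \<psi> x \<noteq> 0}"] by (auto simp: bounded_iff)
  obtain L :: nat where L: "R \<le> real L" using real_arch_simple by blast
  have supp: "\<bar>x\<bar> \<le> real L" if "\<psi> x \<noteq> 0" for x using R[OF that] L by simp
  show ?thesis
  proof (intro exI[of _ "4 * L + 2 * C"] allI impI)
    fix j assume j: "4 * L + 2 * C \<le> j"
    let ?M = "{k. inside_unit (wavelet_fun \<phi> \<psi> (int j, k)) \<and> (int j, k) \<notin> \<Lambda> - B}"
    let ?K = "{int L .. 2 ^ j - int L} - ?M"
    have inside: "inside_unit (wavelet_fun \<phi> \<psi> (int j, k))" if k: "k \<in> {int L .. 2 ^ j - int L}" for k
    proof -
      have "x \<in> {0..1}" if "wavelet_fun \<phi> \<psi> (int j, k) x \<noteq> 0" for x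
      proof -
        have "\<psi> (2 ^ j * x - of_int k) \<noteq> 0"
          using that by (simp add: powr_realpow)
        from supp[OF this] have "of_int k - real L \<le> 2 ^ j * x" "2 ^ j * x \<le> of_int k + real L"
          by auto
        moreover have "real L \<le> of_int k" "of_int k + real L \<le> 2 ^ j"
        proof -
          have "real_of_int (int L) \<le> of_int k" using k unfolding of_int_le_iff by simp
          then show "real L \<le> of_int k" by simp
          have "real_of_int (k + int L) \<le> real_of_int (2 ^ j)" using k unfolding of_int_le_iff by simp
          then show "of_int k + real L \<le> 2 ^ j" by simp
        qed
        ultimately have "0 \<le> 2 ^ j * x" "2 ^ j * x \<le> 2 ^ j * 1" by linarith+
        then show ?thesis
          using mult_le_cancel_left_pos[of "2 ^ j :: real" 0 x]
            mult_le_cancel_left_pos[of "2 ^ j :: real" x 1] by simp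
      qed
      then show ?thesis
        unfolding inside_unit_def by (intro closure_minimal) auto
    qed
    have "2 ^ j / 2 \<le> real (card ?K)"
    proof -
      have "4 * L + 2 * C < 2 ^ j" using j less_exp[of j] by linarith
      then have big: "4 * real L + 2 * real C < 2 ^ j"
        by (metis (mono_tags, lifting) of_nat_add of_nat_less_iff of_nat_mult
            of_nat_numeral of_nat_power)
      have "card {int L .. 2 ^ j - int L} - card ?M \<le> card ?K"
        using missing by (intro diff_card_le_card_Diff) auto
      then have "int (card {int L .. 2 ^ j - int L}) - int C \<le> int (card ?K)"
        using missing[rule_format, of "int j"] by linarith
      moreover have "2 ^ j - 2 * int L + 1 \<le> int (card {int L .. 2 ^ j - int L})" by simp
      ultimately have "2 ^ j - 2 * int L - int C \<le> int (card ?K)" by linarith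
      then have "real_of_int (2 ^ j - 2 * int L - int C) \<le> real_of_int (int (card ?K))"
        unfolding of_int_le_iff .
      then show ?thesis using big by simp
    qed
    moreover have "(int j, k) \<in> \<Lambda> - B" if "k \<in> ?K" for k
      using that inside by blast
    ultimately show "\<exists>Ks. finite Ks \<and> 2 ^ j / 2 \<le> real (card Ks) \<and>
        (\<forall>k\<in>Ks. (int j, k) \<in> \<Lambda> \<and> inside_unit (wavelet_fun \<phi> \<psi> (int j, k)) \<and>
          (\<forall>x\<in>{0..1}. b (int j, k) x = wavelet_fun \<phi> \<psi> (int j, k) x))"
      using interior by (intro exI[of _ ?K]) blast
  qed
qed

lemma wavelet_fourier_transform_nonzero:
  assumes "compactly_supported_wavelet \<phi> \<psi>"
  shows "\<exists>\<omega>. (\<integral>x. iexp (\<omega> * x) * complex_of_real (\<psi> x) \<partial>lborel) \<noteq> 0"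
proof (rule fourier_transform_nonzero)
  have "wavelet_fun \<phi> \<psi> (0, 0) = \<psi>" by (rule ext) simp
  then have sq: "square_integrable lborel \<psi>" and one: "(\<integral>x. \<psi> x * \<psi> x \<partial>lborel) = 1"
    using assms
    by (auto simp: compactly_supported_wavelet_def orthonormal_basis_L2_def
        simp del: wavelet_fun.simps elim!: allE[of _ "0 :: int"])
  have "bounded (closure {x. \<psi> x \<noteq> 0})"
    using assms by (auto simp: compactly_supported_wavelet_def compact_imp_bounded)
  then obtain R where "\<And>x. \<psi> x \<noteq> 0 \<Longrightarrow> \<bar>x\<bar> \<le> R"
    using closure_subset[of "{x. \<psi> x \<noteq> 0}"] by (auto simp: bounded_iff)
  then show "integrable lborel \<psi>"
    by (rule compact_support_square_integrable_imp_integrable[OF sq])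
  show "\<not> (AE x in lborel. \<psi> x = 0)"
  proof
    assume "AE x in lborel. \<psi> x = 0"
    then have "(\<integral>x. \<psi> x * \<psi> x \<partial>lborel) = 0"
      by (intro integral_eq_zero_AE) auto
    with one show False by simp
  qed
qed

lemma square_integrable_cube_bounded:
  fixes f :: "real ^ 'd \<Rightarrow> real"
  assumes f: "f \<in> borel_measurable borel" and bound: "\<And>x. \<bar>f x\<bar> \<le> A"
  shows "square_integrable cube_measure f"
proof -
  interpret finite_measure "cube_measure :: (real ^ 'd) measure"
    by (rule finite_measureI)
        (simp add: space_restrict_space emeasure_restrict_space emeasure_unit_cube)
  have m: "f \<in> borel_measurable cube_measure"
    using f by (intro measurable_restrict_space1) simp
  have "(f x)\<^sup>2 \<le> A\<^sup>2" for x
    using power_mono[OF bound[of x], of 2] by simp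
  then have "integrable cube_measure (\<lambda>x. (f x)\<^sup>2)"
    using m by (intro integrable_const_bound[of _ "A\<^sup>2"]) auto
  with m show ?thesis by (simp add: square_integrable_def)
qed

text \<open>Both risks are bounded for the same set \<open>S\<close> of indices. For every \<open>l \<in> S\<close> the two bounds
add up to \<open>2/n\<close> if \<open>l\<close> belongs to \<open>I\<close>, and to the sum of the two squared coefficients at \<open>l\<close>
otherwise; \<open>\<delta>\<close> is a common lower bound of these two values.\<close>

lemma sum_of_risks_cos_sin:
  fixes b :: "windex \<Rightarrow> real \<Rightarrow> real" and I :: "('d::finite \<Rightarrow> windex) set" and X :: "nat \<Rightarrow> 'a \<Rightarrow> real ^ 'd"
  assumes b: "orthonormal_L2 unit_interval_measure b \<Lambda>" and I: "I \<subseteq> {l. \<forall>r. l r \<in> \<Lambda>}"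
    and Ks: "finite Ks" "\<And>k. k \<in> Ks \<Longrightarrow> (j, k) \<in> \<Lambda>"
      "\<And>k. k \<in> Ks \<Longrightarrow> inside_unit (wavelet_fun \<phi> \<psi> (j, k))"
      "\<And>k x. k \<in> Ks \<Longrightarrow> x \<in> {0..1} \<Longrightarrow> b (j, k) x = wavelet_fun \<phi> \<psi> (j, k) x"
    and j: "j \<ge> 0" and q: "q = 2 powr of_int j"
    and design: "regression_design n M X \<epsilon>" and n: "n \<ge> 1"
    and \<delta>: "0 \<le> \<delta>" "\<delta> \<le> 2 / real n"
      "\<delta> \<le> a\<^sup>2 * ((cmod (\<integral>x. iexp (\<omega> * x) * complex_of_real (\<psi> x) \<partial>lborel))\<^sup>2 / q) ^ CARD('d)"
  shows "ennreal (real (card Ks) ^ CARD('d) * \<delta>) \<le>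
      risk M X \<epsilon> (wavelet_estimator b I n) (\<lambda>x. a * cos (q * \<omega> * (\<Sum>r\<in>UNIV. x $ r))) +
      risk M X \<epsilon> (wavelet_estimator b I n) (\<lambda>x. a * sin (q * \<omega> * (\<Sum>r\<in>UNIV. x $ r)))"
    (is "_ \<le> risk M X \<epsilon> ?est ?f1 + risk M X \<epsilon> ?est ?f2")
proof -
  let ?P = "PiE (UNIV :: 'd set) (\<lambda>_. Ks)"
  define S where "S = (\<lambda>k r. (j, k r)) ` ?P"
  have inj: "inj_on (\<lambda>k r. (j, k r)) ?P" by (auto simp: inj_on_def fun_eq_iff)
  have finS: "finite S" unfolding S_def using Ks(1) by (intro finite_imageI finite_PiE) auto
  have cardS: "card S = card Ks ^ CARD('d)"
    unfolding S_def by (simp add: card_image[OF inj] card_PiE)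
  have S: "S \<subseteq> {l. \<forall>r. l r \<in> \<Lambda>}" using Ks(2) by (auto simp: S_def)
  define d where "d f l = (\<integral>x. f x * tensor_wavelet b l x \<partial>cube_measure)"
    for f :: "real ^ 'd \<Rightarrow> real" and l
  have energy: "(d ?f1 l)\<^sup>2 + (d ?f2 l)\<^sup>2
      = a\<^sup>2 * ((cmod (\<integral>x. iexp (\<omega> * x) * complex_of_real (\<psi> x) \<partial>lborel))\<^sup>2 / q) ^ CARD('d)"
    if lS: "l \<in> S" for l
  proof -
    obtain k where l: "l = (\<lambda>r. (j, k r))" and "k \<in> ?P"
      using lS unfolding S_def by blast
    then have k: "k r \<in> Ks" for r by (simp add: PiE_iff)
    have one: "square_integrable unit_interval_measure (\<lambda>_. 1)"
      by (simp add: square_integrable_def integrable_restrict_space)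
    have int: "integrable unit_interval_measure (b (j, k r))" for r
      using square_integrable_mult[OF _ one, of "b (j, k r)"] b k Ks(2)
      by (auto simp: orthonormal_L2_def)
    show ?thesis
      using sq_coefficients_cos_sin[where k = k and b = b and \<omega> = \<omega>,
          OF j q Ks(3)[OF k] Ks(4)[OF k] int]
      by (simp add: d_def l mult.assoc power_mult_distrib flip: distrib_left)
  qed
  have risk: "(\<Sum>l\<in>S. if l \<in> I then ennreal (1 / real n) else ennreal ((d f l)\<^sup>2)) \<le> risk M X \<epsilon> ?est f"
    if "f \<in> borel_measurable borel" "\<And>x. \<bar>f x\<bar> \<le> \<bar>a\<bar>" for f
    unfolding d_def
        using risk_ge_variance_or_bias
            [OF b I finS S square_integrable_cube_bounded[OF that] that(1) design n] .
  have "ennreal (real (card Ks) ^ CARD('d) * \<delta>) = (\<Sum>l\<in>S. ennreal \<delta>)"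
    using \<delta> by (simp add: cardS ennreal_mult ennreal_of_nat_eq_real_of_nat)
  also have "\<dots> \<le> (\<Sum>l\<in>S. (if l \<in> I then ennreal (1 / real n) else ennreal ((d ?f1 l)\<^sup>2)) +
      (if l \<in> I then ennreal (1 / real n) else ennreal ((d ?f2 l)\<^sup>2)))"
  proof (intro sum_mono)
    fix l assume l: "l \<in> S"
    show "ennreal \<delta> \<le> (if l \<in> I then ennreal (1 / real n) else ennreal ((d ?f1 l)\<^sup>2)) +
      (if l \<in> I then ennreal (1 / real n) else ennreal ((d ?f2 l)\<^sup>2))"
    proof (cases "l \<in> I")
      case True
      have "ennreal \<delta> \<le> ennreal (1 / real n + 1 / real n)"
        using \<delta> by (intro ennreal_leI) simp
      also have "\<dots> = ennreal (1 / real n) + ennreal (1 / real n)"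
        by (rule ennreal_plus) auto
      finally show ?thesis using True by simp
    next
      case False
      have "ennreal \<delta> \<le> ennreal ((d ?f1 l)\<^sup>2 + (d ?f2 l)\<^sup>2)"
        using \<delta> energy[OF l] by (intro ennreal_leI) simp
      also have "\<dots> = ennreal ((d ?f1 l)\<^sup>2) + ennreal ((d ?f2 l)\<^sup>2)"
        by (rule ennreal_plus) auto
      finally show ?thesis using False by simp
    qed
  qed
  also have "\<dots> \<le> risk M X \<epsilon> ?est ?f1 + risk M X \<epsilon> ?est ?f2"
    unfolding sum.distrib by (intro add_mono risk) (auto simp: abs_mult intro!: mult_left_le)
  finally show ?thesis .
qed

lemma dyadic_scale:
  assumes "N \<ge> (1::real)"
  obtains m :: nat where "N \<le> 2 ^ m" "2 ^ m \<le> 2 * N"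
proof
  let ?m = "nat \<lceil>log 2 N\<rceil>"
  have "0 \<le> log 2 N" using assms by simp
  then have m: "log 2 N \<le> real ?m" "real ?m \<le> log 2 N + 1" by linarith+
  have "N = 2 powr log 2 N" using assms by simp
  also have "\<dots> \<le> 2 powr real ?m" using m by simp
  finally show "N \<le> 2 ^ ?m" by (simp add: powr_realpow)
  have "2 powr real ?m \<le> 2 powr (log 2 N + 1)" using m by simp
  also have "\<dots> = 2 * N" using assms by (simp add: powr_add)
  finally show "2 ^ ?m \<le> 2 * N" by (simp add: powr_realpow)
qed

theorem theorem4:
  fixes \<phi> \<psi> :: "real \<Rightarrow> real" and \<Lambda> :: "windex set" and b :: "windex \<Rightarrow> real \<Rightarrow> real"
    and \<alpha> K :: real
  assumes "unit_interval_wavelet_basis \<phi> \<psi> \<Lambda> b"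
    and "0 < \<alpha>" and "\<alpha> \<le> 1" and "0 < K"
  shows "\<exists>c>0. \<forall>n\<ge>1. \<forall>I \<subseteq> {l. \<forall>r. l r \<in> \<Lambda>}.
    \<forall>(M :: 'a measure) (X :: nat \<Rightarrow> 'a \<Rightarrow> real ^ 'd) (\<epsilon> :: nat \<Rightarrow> 'a \<Rightarrow> real).
      regression_design n M X \<epsilon> \<longrightarrow>
      (SUP f0 \<in> additive_ridge_class \<alpha> K. risk M X \<epsilon> (wavelet_estimator b I n) f0)
        \<ge> ennreal (c * real n powr (- (2 * \<alpha> / (2 * \<alpha> + real CARD('d)))))"
proof -
  let ?d = "CARD('d)"
  define p where "p = 2 * \<alpha> + real ?d"
  have p: "p > 0" using assms(2) by (simp add: p_def)
  have b: "orthonormal_L2 unit_interval_measure b \<Lambda>"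
    using assms(1) by (auto simp: unit_interval_wavelet_basis_def orthonormal_basis_L2_def
        orthonormal_L2_def)
  obtain \<omega> where \<omega>: "(\<integral>x. iexp (\<omega> * x) * complex_of_real (\<psi> x) \<partial>lborel) \<noteq> 0"
    using wavelet_fourier_transform_nonzero[of \<phi> \<psi>] assms(1)
    by (auto simp: unit_interval_wavelet_basis_def)
  define \<gamma> where "\<gamma> = (cmod (\<integral>x. iexp (\<omega> * x) * complex_of_real (\<psi> x) \<partial>lborel))\<^sup>2"
  have \<gamma>: "\<gamma> > 0" using \<omega> by (simp add: \<gamma>_def)
  obtain j0 where j0: "\<And>j. j \<ge> j0 \<Longrightarrow> \<exists>Ks. finite Ks \<and> 2 ^ j / 2 \<le> real (card Ks) \<and>
      (\<forall>k\<in>Ks. (int j, k) \<in> \<Lambda> \<and> inside_unit (wavelet_fun \<phi> \<psi> (int j, k)) \<and>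
        (\<forall>x\<in>{0..1}. b (int j, k) x = wavelet_fun \<phi> \<psi> (int j, k) x))"
    using many_interior_wavelets[OF assms(1)] by blast
  define A where "A = K / (1 + 2 * \<bar>\<omega>\<bar> powr \<alpha>)"
  have den: "1 + 2 * \<bar>\<omega>\<bar> powr \<alpha> > 0" by (simp add: add_pos_nonneg)
  have A: "A > 0" "A * (1 + 2 * \<bar>\<omega>\<bar> powr \<alpha>) \<le> K" using den assms(4) by (simp_all add: A_def)
  \<comment> \<open>Rounding to a power of two gives \<open>N \<le> q \<le> Q N\<close> for the scale \<open>q\<close> chosen below;
    the factor \<open>2\<^sup>j\<^sup>0\<close> makes sure that the level is high enough even for \<open>n = 1\<close>.\<close>
  define Q :: real where "Q = 2 ^ (j0 + 1)"
  have Q: "Q > 0" by (simp add: Q_def)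
  define c1 where "c1 = min 2 (A\<^sup>2 * \<gamma> ^ ?d * Q powr - p)"
  have c1: "c1 > 0" using A \<gamma> Q by (simp add: c1_def)
  \<comment> \<open>\<open>c1 / n\<close> is a lower bound of the contribution of each index. The power of two
    comes from the number of indices, which is at least \<open>(N/2)\<^sup>d\<close>, and the other factor from
    passing from the sum of two risks to the supremum.\<close>
  define c where "c = c1 / 2 / 2 ^ ?d"
  have c: "c > 0" using c1 by (simp add: c_def)
  show ?thesis
  proof (intro exI[of _ c] conjI allI impI c)
    fix n :: nat and I :: "('d \<Rightarrow> windex) set" and M :: "'a measure"
      and X :: "nat \<Rightarrow> 'a \<Rightarrow> real ^ 'd" and \<epsilon> :: "nat \<Rightarrow> 'a \<Rightarrow> real"
    assume n: "1 \<le> n" and I: "I \<subseteq> {l. \<forall>r. l r \<in> \<Lambda>}" and design: "regression_design n M X \<epsilon>"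
    \<comment> \<open>At the scale \<open>N\<close> the energy \<open>q\<^bsup>-(2\<alpha>+d)\<^esup>\<close> of a coefficient balances the variance
      \<open>1/n\<close>.\<close>
    define N where "N = real n powr (1 / p)"
    have N: "N \<ge> 1" using n p by (simp add: N_def ge_one_powr_ge_zero)
    have Np: "N powr p = real n" using n p by (simp add: N_def powr_powr)
    obtain m :: nat where m: "N \<le> 2 ^ m" "2 ^ m \<le> 2 * N" using dyadic_scale[OF N] .
    define q :: real where "q = 2 ^ (j0 + m)"
    have q: "q = 2 powr of_int (int (j0 + m))"
      using powr_realpow[of "2 :: real" "j0 + m"] by (simp add: q_def)
    have "1 * N \<le> 2 ^ j0 * 2 ^ m" using m N by (intro mult_mono) auto
    then have Nq: "N \<le> q" by (simp add: q_def power_add)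
    have qQ: "q \<le> Q * N" using m by (simp add: q_def Q_def power_add)
    have q1: "q \<ge> 1" using N Nq by simp
    obtain Ks where Ks: "finite Ks" "q / 2 \<le> real (card Ks)"
      "\<And>k. k \<in> Ks \<Longrightarrow> (int (j0 + m), k) \<in> \<Lambda>"
      "\<And>k. k \<in> Ks \<Longrightarrow> inside_unit (wavelet_fun \<phi> \<psi> (int (j0 + m), k))"
      "\<And>k x. k \<in> Ks \<Longrightarrow> x \<in> {0..1} \<Longrightarrow>
         b (int (j0 + m), k) x = wavelet_fun \<phi> \<psi> (int (j0 + m), k) x"
      using j0[of "j0 + m"] unfolding q_def by (metis le_add1)
    define a where "a = A * q powr - \<alpha>"
    have "c1 / real n \<le> A\<^sup>2 * \<gamma> ^ ?d * Q powr - p / real n"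
      by (intro divide_right_mono) (simp_all add: c1_def)
    also have "\<dots> = A\<^sup>2 * \<gamma> ^ ?d * (Q * N) powr - p"
      using Q N by (simp add: powr_mult powr_minus Np divide_inverse)
    also have "\<dots> \<le> A\<^sup>2 * \<gamma> ^ ?d * q powr - p"
      using A \<gamma> p q1 qQ by (intro mult_left_mono powr_mono2') auto
    also have "\<dots> = a\<^sup>2 * (\<gamma> / q) ^ ?d"
    proof -
      have "q powr - p = q powr (- \<alpha> + - \<alpha>) * q powr - real ?d"
        unfolding p_def powr_add[symmetric] by simp
      also have "\<dots> = (q powr - \<alpha>)\<^sup>2 / q ^ ?d"
        using q1 by (simp only: powr_add powr_minus[of q "real ?d"] powr_realpow)
          (simp add: power2_eq_square powr_realpow divide_inverse)
      finally show ?thesis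
        by (simp add: a_def power_mult_distrib power_divide)
    qed
    finally have \<delta>: "c1 / real n \<le> a\<^sup>2 * (\<gamma> / q) ^ ?d" .
    let ?R = "risk M X \<epsilon> (wavelet_estimator b I n)"
    let ?s = "SUP f0 \<in> additive_ridge_class \<alpha> K. ?R f0"
    have upper: "?R (\<lambda>x. a * g (q * \<omega> * (\<Sum>r\<in>UNIV. x $ r))) \<le> ?s"
      if g: "\<And>s. \<bar>g s\<bar> \<le> 1" "\<And>s t. \<bar>g s - g t\<bar> \<le> \<bar>s - t\<bar>" for g :: "real \<Rightarrow> real"
    proof (rule SUP_upper)
      have "(\<lambda>u. a * g (q * \<omega> * u)) \<in> holder_ball \<alpha> (real ?d) K"
        unfolding a_def using A by (intro rescaled_in_holder_ball g assms q1) auto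
      then show "(\<lambda>x :: real ^ 'd. a * g (q * \<omega> * (\<Sum>r\<in>UNIV. x $ r))) \<in> additive_ridge_class \<alpha> K"
        unfolding additive_ridge_class_def mem_Collect_eq
        by (intro exI[of _ "\<lambda>u. a * g (q * \<omega> * u)"]) simp
    qed
    have cos_lip: "\<bar>cos s - cos t\<bar> \<le> \<bar>s - t\<bar>" and sin_lip: "\<bar>sin s - sin t\<bar> \<le> \<bar>s - t\<bar>" for s t :: real
      using field_differentiable_bound[of UNIV cos "\<lambda>x. - sin x" 1 s t]
        field_differentiable_bound[of UNIV sin cos 1 s t]
      by (auto intro!: derivative_eq_intros)
    have "2 * (c * real n powr (- (2 * \<alpha> / p))) = (N / 2) ^ ?d * (c1 / real n)"
    proof -
      have "N ^ ?d = real n powr (real ?d / p)"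
        using N n by (simp add: N_def powr_realpow[symmetric] powr_powr)
      also have "\<dots> = real n powr (1 + - (2 * \<alpha> / p))"
        using p by (simp add: p_def field_simps)
      also have "\<dots> = real n * real n powr (- (2 * \<alpha> / p))"
        using n by (simp only: powr_add) simp
      finally show ?thesis using n by (simp add: c_def power_divide)
    qed
    also have "\<dots> \<le> real (card Ks) ^ ?d * (c1 / real n)"
      using Ks(2) Nq N c1 by (intro mult_right_mono power_mono) auto
    finally have "ennreal (2 * (c * real n powr (- (2 * \<alpha> / p))))
        \<le> ennreal (real (card Ks) ^ ?d * (c1 / real n))"
      by (rule ennreal_leI)
    also have "\<dots> \<le> ?R (\<lambda>x. a * cos (q * \<omega> * (\<Sum>r\<in>UNIV. x $ r)))
        + ?R (\<lambda>x. a * sin (q * \<omega> * (\<Sum>r\<in>UNIV. x $ r)))"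
    proof (rule sum_of_risks_cos_sin[OF b I Ks(1,3,4,5) _ q design n])
      show "c1 / real n \<le> 2 / real n" by (intro divide_right_mono) (simp_all add: c1_def)
    qed (use c1 \<delta> in \<open>auto simp: \<gamma>_def\<close>)
    also have "\<dots> \<le> ?s + ?s"
      by (intro add_mono upper cos_lip sin_lip) auto
    also have "\<dots> = 2 * ?s"
      by (rule mult_2[symmetric])
    also have "ennreal (2 * (c * real n powr (- (2 * \<alpha> / p))))
        = 2 * ennreal (c * real n powr (- (2 * \<alpha> / p)))"
      using c by (subst ennreal_mult) auto
    finally have "ennreal (c * real n powr (- (2 * \<alpha> / p))) \<le> ?s"
      by (rule ennreal_mult_le_mult_iff[THEN iffD1, rotated 2]) auto
    then show "ennreal (c * real n powr (- (2 * \<alpha> / (2 * \<alpha> + real ?d)))) \<le> ?s"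
      unfolding p_def .
  qed
qed

end
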